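(* Let $D=(\alpha,\beta)_{\mathbb Q}$ be a quaternion division algebra and $p\neq 2$ a prime with $v_p(\alpha)=v_p(\beta)=0$, where $\alpha$ is a square in $\mathbb Q_p$ and where, if $-1$ has a square root in $D$, $\beta=-1$. Identify $G_p$ with $\mathrm{SL}_2(\mathbb Q_p)$ via the isomorphism $x_1+x_2e_2+x_3e_3+x_4e_4\mapsto\begin{pmatrix}x_1+x_2\sqrt\alpha & \beta(x_3+x_4\sqrt\alpha)\\ x_3-x_4\sqrt\alpha & x_1-x_2\sqrt\alpha\end{pmatrix}$, so that the norm-1 group $G$ of $D$ acts on the tree $\Delta_p$. Then the following are equivalent: (i) $-1$ has a square root in $D$; (ii) $G$ contains an element that stabilizes the standard apartment $\Sigma_0$ and acts on it as a reflection; (iii) the action of $G$ on $\Delta_p$ is strongly transitive with respect to some apartment system.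
   Context: $(\alpha,\beta)_{\mathbb Q}$ has basis $1,e_2,e_3,e_4$ with $e_2^2=\alpha$, $e_3^2=\beta$, $e_2e_3=-e_3e_2=e_4$ and norm $N(x)=x_1^2-\alpha x_2^2-\beta x_3^2+\alpha\beta x_4^2$; $G$, $G_p$ are the norm-1 groups of $D$ and $D_p=D\otimes\mathbb Q_p$. $\Delta_p$ is the Bruhat–Tits tree of $\mathrm{SL}_2(\mathbb Q_p)$ (vertices: homothety classes of $\mathbb Z_p$-lattices in $\mathbb Q_p^2$, adjacent if representatives satisfy $L\supset L'\supset pL$), a building with chambers the edges and infinite dihedral Weyl group; apartments are the bi-infinite lines. The standard apartment $\Sigma_0$ is the line with vertices $[\mathbb Z_p\oplus p^n\mathbb Z_p]$, $n\in\mathbb Z$; its stabilizer in $\mathrm{SL}_2(\mathbb Q_p)$ is the monomial group, with diagonal matrices acting as translations and non-diagonal monomial matrices as reflections. An apartment system is a set $\mathcal A$ of apartments such that any two chambers lie in a common member of $\mathcal A$; the action is strongly transitive with respect to a $G$-invariant apartment system $\mathcal A$ if $G$ is transitive on pairs $(\Sigma,C)$ with $\Sigma\in\mathcal A$ and $C$ an edge of $\Sigma$. *)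

theory Defs
  imports Complex_Main "HOL-Computational_Algebra.Primes"
begin

definition vp_rat :: "nat \<Rightarrow> rat \<Rightarrow> int" where
  "vp_rat p q = int (multiplicity (int p) (fst (quotient_of q)))
              - int (multiplicity (int p) (snd (quotient_of q)))"

definition padic_abs :: "nat \<Rightarrow> rat \<Rightarrow> real" where
  "padic_abs p q = (if q = 0 then 0 else (real p) powi (- vp_rat p q))"

text \<open>A field of characteristic 0 with an absolute value extending the p-adic one,
 in which Q is dense and which is complete.  This characterises Q_p up to unique
 isometric isomorphism.\<close>

definition is_Qp :: "nat \<Rightarrow> ('k::field_char_0 \<Rightarrow> real) \<Rightarrow> bool" where
  "is_Qp p absv \<longleftrightarrow>
     (\<forall>x. absv x \<ge> 0 \<and> (absv x = 0 \<longleftrightarrow> x = 0)) \<and>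
     (\<forall>x y. absv (x * y) = absv x * absv y) \<and>
     (\<forall>x y. absv (x + y) \<le> max (absv x) (absv y)) \<and>
     (\<forall>q. absv (of_rat q) = padic_abs p q) \<and>
     (\<forall>x e. e > 0 \<longrightarrow> (\<exists>q. absv (x - of_rat q) < e)) \<and>
     (\<forall>X :: nat \<Rightarrow> 'k.
        (\<forall>e>0. \<exists>N. \<forall>m\<ge>N. \<forall>n\<ge>N. absv (X m - X n) < e) \<longrightarrow>
        (\<exists>l. \<forall>e>0. \<exists>N. \<forall>n\<ge>N. absv (X n - l) < e))"

type_synonym quat = "rat \<times> rat \<times> rat \<times> rat"

text \<open>Basis 1,e2,e3,e4 with e2^2 = alpha, e3^2 = beta, e2 e3 = - e3 e2 = e4.\<close>
definition qmul :: "rat \<Rightarrow> rat \<Rightarrow> quat \<Rightarrow> quat \<Rightarrow> quat" where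
  "qmul \<alpha> \<beta> x y = (case x of (a1,a2,a3,a4) \<Rightarrow> case y of (b1,b2,b3,b4) \<Rightarrow>
     (a1*b1 + \<alpha>*a2*b2 + \<beta>*a3*b3 - \<alpha>*\<beta>*a4*b4,
      a1*b2 + a2*b1 - \<beta>*a3*b4 + \<beta>*a4*b3,
      a1*b3 + a3*b1 + \<alpha>*a2*b4 - \<alpha>*a4*b2,
      a1*b4 + a4*b1 + a2*b3 - a3*b2))"

definition qone :: quat where "qone = (1,0,0,0)"
definition qzero :: quat where "qzero = (0,0,0,0)"

definition qnorm :: "rat \<Rightarrow> rat \<Rightarrow> quat \<Rightarrow> rat" where
  "qnorm \<alpha> \<beta> x = (case x of (x1,x2,x3,x4) \<Rightarrow>
     x1^2 - \<alpha>*x2^2 - \<beta>*x3^2 + \<alpha>*\<beta>*x4^2)"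

definition is_division_quat :: "rat \<Rightarrow> rat \<Rightarrow> bool" where
  "is_division_quat \<alpha> \<beta> \<longleftrightarrow>
     (\<forall>x. x \<noteq> qzero \<longrightarrow> (\<exists>y. qmul \<alpha> \<beta> x y = qone \<and> qmul \<alpha> \<beta> y x = qone))"

definition has_sqrt_minus1 :: "rat \<Rightarrow> rat \<Rightarrow> bool" where
  "has_sqrt_minus1 \<alpha> \<beta> \<longleftrightarrow> (\<exists>x. qmul \<alpha> \<beta> x x = (-1,0,0,0))"

definition normone :: "rat \<Rightarrow> rat \<Rightarrow> quat set" where
  "normone \<alpha> \<beta> = {x. qnorm \<alpha> \<beta> x = 1}"

type_synonym 'k mat2 = "'k \<times> 'k \<times> 'k \<times> 'k"   (* (a,b,c,d) = [[a,b],[c,d]] *)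

text \<open>The isomorphism of the paper, with s a fixed square root of alpha in Q_p.\<close>
definition qmat :: "'k::field_char_0 \<Rightarrow> rat \<Rightarrow> quat \<Rightarrow> 'k mat2" where
  "qmat s \<beta> x = (case x of (x1,x2,x3,x4) \<Rightarrow>
     (of_rat x1 + of_rat x2 * s, of_rat \<beta> * (of_rat x3 + of_rat x4 * s),
      of_rat x3 - of_rat x4 * s, of_rat x1 - of_rat x2 * s))"

definition mat_apply :: "'k::field mat2 \<Rightarrow> 'k \<times> 'k \<Rightarrow> 'k \<times> 'k" where
  "mat_apply M u = (case M of (a,b,c,d) \<Rightarrow> case u of (u1,u2) \<Rightarrow> (a*u1 + b*u2, c*u1 + d*u2))"

definition scal :: "'k::field \<Rightarrow> ('k \<times> 'k) set \<Rightarrow> ('k \<times> 'k) set" where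
  "scal c L = (\<lambda>(u1,u2). (c*u1, c*u2)) ` L"

definition is_lattice :: "('k::field_char_0 \<Rightarrow> real) \<Rightarrow> ('k \<times> 'k) set \<Rightarrow> bool" where
  "is_lattice absv L \<longleftrightarrow> (\<exists>u1 u2 w1 w2. u1*w2 - u2*w1 \<noteq> 0 \<and>
      L = {(a*u1 + b*w1, a*u2 + b*w2) | a b. absv a \<le> 1 \<and> absv b \<le> 1})"

definition hclass :: "('k::field \<times> 'k) set \<Rightarrow> ('k \<times> 'k) set set" where
  "hclass L = {scal c L | c. c \<noteq> 0}"

definition tree_vertices :: "('k::field_char_0 \<Rightarrow> real) \<Rightarrow> ('k \<times> 'k) set set set" where
  "tree_vertices absv = {hclass L | L. is_lattice absv L}"

definition tree_adj :: "nat \<Rightarrow> ('k::field_char_0 \<Rightarrow> real) \<Rightarrow> ('k \<times> 'k) set set \<Rightarrow> ('k \<times> 'k) set set \<Rightarrow> bool" where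
  "tree_adj p absv v w \<longleftrightarrow> v \<in> tree_vertices absv \<and> w \<in> tree_vertices absv \<and>
     (\<exists>L\<in>v. \<exists>L'\<in>w. scal (of_nat p) L \<subset> L' \<and> L' \<subset> L)"

definition tree_chambers :: "nat \<Rightarrow> ('k::field_char_0 \<Rightarrow> real) \<Rightarrow> ('k \<times> 'k) set set set set" where
  "tree_chambers p absv = {{v, w} | v w. tree_adj p absv v w}"

definition is_apartment :: "nat \<Rightarrow> ('k::field_char_0 \<Rightarrow> real) \<Rightarrow> ('k \<times> 'k) set set set \<Rightarrow> bool" where
  "is_apartment p absv S \<longleftrightarrow> (\<exists>f :: int \<Rightarrow> ('k \<times> 'k) set set.
      inj f \<and> (\<forall>n. tree_adj p absv (f n) (f (n + 1))) \<and> S = range f)"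

definition edge_of :: "nat \<Rightarrow> ('k::field_char_0 \<Rightarrow> real) \<Rightarrow> ('k \<times> 'k) set set set \<Rightarrow> ('k \<times> 'k) set set set \<Rightarrow> bool" where
  "edge_of p absv S C \<longleftrightarrow> C \<in> tree_chambers p absv \<and> C \<subseteq> S"

definition is_apartment_system :: "nat \<Rightarrow> ('k::field_char_0 \<Rightarrow> real) \<Rightarrow> ('k \<times> 'k) set set set set \<Rightarrow> bool" where
  "is_apartment_system p absv A \<longleftrightarrow> (\<forall>S\<in>A. is_apartment p absv S) \<and>
     (\<forall>C\<in>tree_chambers p absv. \<forall>C'\<in>tree_chambers p absv. \<exists>S\<in>A. C \<subseteq> S \<and> C' \<subseteq> S)"

definition act_vertex :: "'k::field mat2 \<Rightarrow> ('k \<times> 'k) set set \<Rightarrow> ('k \<times> 'k) set set" where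
  "act_vertex M v = (\<lambda>L. mat_apply M ` L) ` v"

definition act_vset :: "'k::field mat2 \<Rightarrow> ('k \<times> 'k) set set set \<Rightarrow> ('k \<times> 'k) set set set" where
  "act_vset M S = act_vertex M ` S"

definition strongly_transitive_wrt ::
  "nat \<Rightarrow> ('k::field_char_0 \<Rightarrow> real) \<Rightarrow> 'k mat2 set \<Rightarrow> ('k \<times> 'k) set set set set \<Rightarrow> bool" where
  "strongly_transitive_wrt p absv H A \<longleftrightarrow>
     is_apartment_system p absv A \<and>
     (\<forall>g\<in>H. \<forall>S\<in>A. act_vset g S \<in> A) \<and>
     (\<forall>S\<in>A. \<forall>C. edge_of p absv S C \<longrightarrow> (\<forall>S'\<in>A. \<forall>C'. edge_of p absv S' C' \<longrightarrow>
        (\<exists>g\<in>H. act_vset g S = S' \<and> act_vset g C = C')))"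

definition std_vertex :: "nat \<Rightarrow> ('k::field_char_0 \<Rightarrow> real) \<Rightarrow> int \<Rightarrow> ('k \<times> 'k) set set" where
  "std_vertex p absv n = hclass {(a, (of_nat p) powi n * b) | a b. absv a \<le> 1 \<and> absv b \<le> 1}"

definition std_apartment :: "nat \<Rightarrow> ('k::field_char_0 \<Rightarrow> real) \<Rightarrow> ('k \<times> 'k) set set set" where
  "std_apartment p absv = range (std_vertex p absv)"

definition reflects_std :: "nat \<Rightarrow> ('k::field_char_0 \<Rightarrow> real) \<Rightarrow> 'k mat2 \<Rightarrow> bool" where
  "reflects_std p absv g \<longleftrightarrow> act_vset g (std_apartment p absv) = std_apartment p absv \<and>
     (\<exists>c::int. \<forall>n. act_vertex g (std_vertex p absv n) = std_vertex p absv (c - n))"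

end

(* (ii) ==> (i): a matrix of determinant 1 that swaps two vertices at distance 2n of the tree has
   trace of absolute value at most p^(-n); hence a reflection of an apartment has trace 0, and an
   element of G of trace 0 squares to -1.
   (iii) ==> (i): strong transitivity, applied to two adjacent edges of one apartment, yields an
   element of G which (preserving types of vertices) reflects that apartment, and the same trace
   argument applies, since every finite piece of an apartment is a GL_2-translate of a piece of the
   standard one.
   (i) ==> (ii), (iii): when beta = -1, e_3 acts as a reflection of the standard apartment.
   The apartment system is the G-orbit of the standard apartment: two edges lie in a common
   SL_2(Q_p)-translate of it (Bruhat decomposition), and G is dense in SL_2(Q_p). *)

theory Submission
  imports Defs
begin

section \<open>Matrices of size 2\<close>

text \<open>Lattices are handled through bases: a vertex is the coset of a basis matrix modulo
  scalars and right multiplication by GL_2(O), O being the valuation ring. Adjacency, stabilizers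
  and paths thus become matrix identities. Two obstacles shape the rest. Elements of G are rational
  solutions of a quadratic norm equation, so approximating the entries of a matrix of determinant 1
  by rationals does not produce elements of G. The way out is w^2 / N(w) for any quaternion w with
  N(w) nonzero: it has norm 1 and acts as w^2, because scalars act trivially on the tree, while the
  quaternions w themselves are dense in the 2x2 matrices by linear algebra. Moreover determinant 1
  preserves the two types of vertices, so G translates the standard apartment by even amounts only,
  and a reflection is needed to reach the remaining edges. The same parity, in the converse
  direction, forces the element given by strong transitivity to fix the common vertex of the two
  edges instead of shifting the line.\<close>

definition mmul :: "'k::field mat2 \<Rightarrow> 'k mat2 \<Rightarrow> 'k mat2" where
  "mmul M N = (case M of (a,b,c,d) \<Rightarrow> case N of (a',b',c',d') \<Rightarrow>
     (a*a' + b*c', a*b' + b*d', c*a' + d*c', c*b' + d*d'))"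

definition mdet :: "'k::field mat2 \<Rightarrow> 'k" where
  "mdet M = (case M of (a,b,c,d) \<Rightarrow> a*d - b*c)"

definition mtrace :: "'k::field mat2 \<Rightarrow> 'k" where
  "mtrace M = (case M of (a,b,c,d) \<Rightarrow> a + d)"

definition mdiag :: "'k::field \<Rightarrow> 'k \<Rightarrow> 'k mat2" where
  "mdiag a d = (a, 0, 0, d)"

abbreviation mone :: "'k::field mat2" where
  "mone \<equiv> mdiag 1 1"

definition minv :: "'k::field mat2 \<Rightarrow> 'k mat2" where
  "minv M = (case M of (a,b,c,d) \<Rightarrow> (d / mdet M, - b / mdet M, - c / mdet M, a / mdet M))"

lemma mmul_simp [simp]:
  "mmul (a,b,c,d) (a',b',c',d') = (a*a' + b*c', a*b' + b*d', c*a' + d*c', c*b' + d*d')"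
  by (simp add: mmul_def)

lemma mdet_simp [simp]: "mdet (a,b,c,d) = a*d - b*c"
  by (simp add: mdet_def)

lemma mtrace_simp [simp]: "mtrace (a,b,c,d) = a + d"
  by (simp add: mtrace_def)

lemma mat_apply_simp [simp]: "mat_apply (a,b,c,d) (x,y) = (a*x + b*y, c*x + d*y)"
  by (simp add: mat_apply_def)

lemma mmul_assoc: "mmul (mmul L M) N = mmul L (mmul M N)"
  by (cases L rule: prod_cases4; cases M rule: prod_cases4; cases N rule: prod_cases4)
     (simp add: algebra_simps)

lemma mmul_mone [simp]: "mmul mone M = M" "mmul M mone = M"
  by (cases M rule: prod_cases4; simp add: mdiag_def)+

lemma mdet_mmul [simp]: "mdet (mmul M N) = mdet M * mdet N"
  by (cases M rule: prod_cases4; cases N rule: prod_cases4) (simp add: algebra_simps)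

lemma mdet_mdiag [simp]: "mdet (mdiag a d) = a * d"
  by (simp add: mdiag_def)

lemma mmul_mdiag [simp]: "mmul (mdiag a d) (mdiag a' d') = mdiag (a * a') (d * d')"
  by (simp add: mdiag_def)

lemma mscalar_commute: "mmul (mdiag c c) M = mmul M (mdiag c c)"
  by (cases M rule: prod_cases4) (simp add: mdiag_def)

lemma mtrace_mmul_commute: "mtrace (mmul M N) = mtrace (mmul N M)"
  by (cases M rule: prod_cases4; cases N rule: prod_cases4) (simp add: algebra_simps)

lemma minv_right [simp]: "mdet M \<noteq> 0 \<Longrightarrow> mmul M (minv M) = mone"
  by (cases M rule: prod_cases4) (auto simp: minv_def mdiag_def divide_simps)

lemma minv_left [simp]: "mdet M \<noteq> 0 \<Longrightarrow> mmul (minv M) M = mone"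
  by (cases M rule: prod_cases4) (auto simp: minv_def mdiag_def divide_simps mult.commute)

lemma minv_cancel [simp]:
  assumes "mdet M \<noteq> 0"
  shows "mmul M (mmul (minv M) N) = N" "mmul (minv M) (mmul M N) = N"
  using assms by (simp_all flip: mmul_assoc)

lemma mdet_minv [simp]: "mdet M \<noteq> 0 \<Longrightarrow> mdet (minv M) = inverse (mdet M)"
  using mdet_mmul[of M "minv M"] by (simp add: inverse_unique)

lemma mat_apply_mmul [simp]: "mat_apply (mmul M N) x = mat_apply M (mat_apply N x)"
  by (cases M rule: prod_cases4; cases N rule: prod_cases4; cases x) (simp add: algebra_simps)

lemma mat_apply_mone [simp]: "mat_apply mone x = x"
  by (cases x) (simp add: mdiag_def)

lemma image_mmul: "mat_apply (mmul M N) ` L = mat_apply M ` (mat_apply N ` L)"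
  by (simp add: image_image)

lemma image_mone [simp]: "mat_apply mone ` L = L"
  by simp

lemma scal_eq_image: "scal c L = mat_apply (mdiag c c) ` L"
  unfolding scal_def by (rule image_cong) (auto simp: mdiag_def)

text \<open>Scalar matrices are central, so the image of a homothety class can be computed on any
  one representative.\<close>

lemma act_vertex_hclass: "act_vertex M (hclass L) = hclass (mat_apply M ` L)"
proof -
  have "mat_apply M ` scal c L = scal c (mat_apply M ` L)" for c
    by (simp add: scal_eq_image mscalar_commute flip: image_mmul)
  then show ?thesis
    unfolding act_vertex_def hclass_def by auto
qed

lemma act_vertex_mmul: "act_vertex (mmul M N) v = act_vertex M (act_vertex N v)"
  by (simp add: act_vertex_def image_image)

lemma act_vertex_mone [simp]: "act_vertex mone v = v"
  by (simp add: act_vertex_def)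

lemma act_vset_mmul: "act_vset (mmul M N) S = act_vset M (act_vset N S)"
  by (simp add: act_vset_def image_image act_vertex_mmul)

lemma act_vset_mone [simp]: "act_vset mone S = S"
  by (simp add: act_vset_def)

lemma act_vertex_inverse:
  assumes "mdet M \<noteq> 0"
  shows "act_vertex (minv M) (act_vertex M v) = v" "act_vertex M (act_vertex (minv M) v) = v"
  using assms by (simp_all flip: act_vertex_mmul)

lemma inj_act_vertex: "mdet M \<noteq> 0 \<Longrightarrow> inj (act_vertex M)"
  by (metis act_vertex_inverse(1) injI)

lemma hclass_scal: "c \<noteq> 0 \<Longrightarrow> hclass (scal c L) = hclass L"
proof -
  assume c: "c \<noteq> 0"
  have *: "scal d (scal e L) = scal (d * e) L" for d e
    by (simp add: scal_eq_image flip: image_mmul)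
  have "scal d L = scal (d / c * c) L" "d \<noteq> 0 \<Longrightarrow> d / c \<noteq> 0" for d
    using c by simp_all
  with c show ?thesis
    unfolding hclass_def * by (smt (verit) Collect_cong mult_eq_0_iff)
qed

lemma hclass_self: "L \<in> hclass L"
proof -
  have "scal 1 L = L" by (simp add: scal_eq_image)
  then show ?thesis unfolding hclass_def by (metis (mono_tags, lifting) mem_Collect_eq one_neq_zero)
qed

text \<open>Serves only to express entrywise closeness of matrices; the distributive laws below
  carry an estimate of \<open>msub g' g\<close> over to products around it.\<close>

definition msub :: "'k::field mat2 \<Rightarrow> 'k mat2 \<Rightarrow> 'k mat2" where
  "msub M N = (case M of (a,b,c,d) \<Rightarrow> case N of (a',b',c',d') \<Rightarrow> (a - a', b - b', c - c', d - d'))"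

lemma msub_simp [simp]: "msub (a,b,c,d) (a',b',c',d') = (a - a', b - b', c - c', d - d')"
  by (simp add: msub_def)

lemma mmul_msub_left: "mmul L (msub M N) = msub (mmul L M) (mmul L N)"
  by (cases L rule: prod_cases4; cases M rule: prod_cases4; cases N rule: prod_cases4)
     (simp add: algebra_simps)

lemma mmul_msub_right: "mmul (msub M N) L = msub (mmul M L) (mmul N L)"
  by (cases L rule: prod_cases4; cases M rule: prod_cases4; cases N rule: prod_cases4)
     (simp add: algebra_simps)

section \<open>The field of p-adic numbers\<close>

locale Qp_field =
  fixes p :: nat and absv :: "'k::field_char_0 \<Rightarrow> real"
  assumes is_Qp: "is_Qp p absv" and prime: "prime p"
begin

lemma absv_nonneg [simp]: "absv x \<ge> 0"
  using is_Qp unfolding is_Qp_def by metis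

lemma absv_eq_0 [simp]: "absv x = 0 \<longleftrightarrow> x = 0"
  using is_Qp unfolding is_Qp_def by metis

lemma absv_zero [simp]: "absv 0 = 0"
  using absv_eq_0 by blast

lemma absv_pos [simp]: "0 < absv x \<longleftrightarrow> x \<noteq> 0"
  using absv_nonneg[of x] absv_eq_0[of x] by linarith

lemma absv_mult: "absv (x * y) = absv x * absv y"
  using is_Qp unfolding is_Qp_def by metis

lemma absv_add: "absv (x + y) \<le> max (absv x) (absv y)"
  using is_Qp unfolding is_Qp_def by metis

lemma absv_of_rat: "absv (of_rat q) = padic_abs p q"
  using is_Qp unfolding is_Qp_def by metis

lemma rat_dense: "e > 0 \<Longrightarrow> \<exists>q. absv (x - of_rat q) < e"
  using is_Qp unfolding is_Qp_def by metis

lemma absv_one [simp]: "absv 1 = 1"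
  using absv_mult[of 1 1] by simp

lemma absv_minus [simp]: "absv (- x) = absv x"
proof -
  have "absv (-1) * absv (-1) = 1"
    using absv_mult[of "-1" "-1"] by simp
  then have "absv (-1) = 1"
    using absv_nonneg[of "-1"] by (metis abs_of_nonneg abs_mult_self_eq mult_cancel_left2 real_sqrt_abs2 real_sqrt_one)
  then show ?thesis
    using absv_mult[of "-1" x] by simp
qed

lemma absv_diff: "absv (x - y) \<le> max (absv x) (absv y)"
  using absv_add[of x "- y"] by simp

lemma absv_divide: "absv (x / y) = absv x / absv y"
  by (cases "y = 0") (use absv_mult[of "x / y" y] in \<open>auto simp: field_simps\<close>)

lemma absv_inverse: "absv (inverse x) = inverse (absv x)"
  using absv_divide[of 1 x] by (simp add: inverse_eq_divide)

lemma absv_add_le: "absv x \<le> c \<Longrightarrow> absv y \<le> c \<Longrightarrow> absv (x + y) \<le> c"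
  using absv_add[of x y] by linarith

lemma absv_diff_le: "absv x \<le> c \<Longrightarrow> absv y \<le> c \<Longrightarrow> absv (x - y) \<le> c"
  using absv_diff[of x y] by linarith

lemma absv_add_less: "absv x < c \<Longrightarrow> absv y < c \<Longrightarrow> absv (x + y) < c"
  using absv_add[of x y] by linarith

lemma absv_diff_less: "absv x < c \<Longrightarrow> absv y < c \<Longrightarrow> absv (x - y) < c"
  using absv_diff[of x y] by linarith

text \<open>The isosceles triangle principle of ultrametrics, by which absolute values pass between
  an element and its approximations.\<close>

lemma absv_eq_of_close:
  assumes "absv (x - y) < absv x"
  shows "absv y = absv x"
proof (rule antisym)
  show "absv y \<le> absv x"
    using absv_diff[of x "x - y"] assms by simp
  show "absv x \<le> absv y"
    using absv_add[of "x - y" y] assms by simp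
qed

lemma absv_mult_le_one: "absv x \<le> 1 \<Longrightarrow> absv y \<le> 1 \<Longrightarrow> absv (x * y) \<le> 1"
  by (simp add: absv_mult mult_le_one)

lemma p_gt_1 [simp]: "real p > 1"
  using prime prime_gt_1_nat by auto

lemma p_pos [simp]: "real p > 0"
  using p_gt_1 by linarith

lemma p_powi_le_iff [simp]: "real p powi m \<le> real p powi n \<longleftrightarrow> m \<le> n"
  by (metis less_eq_real_def p_gt_1 linorder_not_le power_int_increasing power_int_strict_increasing)

lemma p_powi_less_iff [simp]: "real p powi m < real p powi n \<longleftrightarrow> m < n"
  using p_powi_le_iff[of n m] by linarith

lemma p_powi_eq_iff [simp]: "real p powi m = real p powi n \<longleftrightarrow> m = n"
  using p_powi_le_iff[of n m] p_powi_le_iff[of m n] by linarith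

lemma p_powi_le_1_iff [simp]: "real p powi m \<le> 1 \<longleftrightarrow> m \<le> 0"
  using p_powi_le_iff[of m 0] by (simp del: p_powi_le_iff)

lemma p_powi_ge_1_iff [simp]: "1 \<le> real p powi m \<longleftrightarrow> 0 \<le> m"
  using p_powi_le_iff[of 0 m] by (simp del: p_powi_le_iff)

lemma p_powi_add: "real p powi (m + n) = real p powi m * real p powi n"
  by (rule power_int_add) (use p_pos in auto)

text \<open>A rational number closer to \<open>x\<close> than \<open>absv x\<close> has the same
  absolute value, so the value group is that of the rationals.\<close>

lemma absv_value:
  assumes "x \<noteq> 0"
  obtains k where "absv x = real p powi k"
proof -
  obtain q where q: "absv (x - of_rat q) < absv x"
    using rat_dense[of "absv x" x] assms by auto
  then have "absv x = padic_abs p q"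
    using absv_eq_of_close absv_of_rat by metis
  moreover from this assms have "q \<noteq> 0"
    by (metis absv_eq_0 padic_abs_def)
  ultimately show thesis
    using that by (simp add: padic_abs_def)
qed

definition unif :: 'k where "unif = of_nat p"

lemma unif_nonzero [simp]: "unif \<noteq> 0"
  using p_pos by (simp add: unif_def)

lemma absv_unif: "absv unif = real p powi (-1)"
proof -
  have "vp_rat p (of_nat p) = 1"
    using quotient_of_int[of "int p"] prime prime_gt_1_nat[OF prime] by (simp add: vp_rat_def)
  then have "absv (of_rat (of_nat p)) = real p powi (-1)"
    unfolding absv_of_rat padic_abs_def using p_pos by simp
  then show ?thesis
    by (simp add: unif_def)
qed

lemma absv_unif_powi [simp]: "absv (unif powi n) = real p powi (- n)"
proof -
  have nat: "absv (unif ^ m) = real p powi (- int m)" for m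
  proof (induction m)
    case (Suc m)
    have "real p powi (- int (Suc m)) = real p powi (-1) * real p powi (- int m)"
      unfolding p_powi_add[symmetric] by simp
    with Suc show ?case by (simp add: absv_mult absv_unif)
  qed simp
  show ?thesis
  proof (cases "n \<ge> 0")
    case True
    then show ?thesis using nat[of "nat n"] by (simp add: power_int_nonneg_exp)
  next
    case False
    then have "unif powi n = inverse (unif ^ nat (- n))"
      by (simp add: power_int_def power_inverse)
    then show ?thesis using nat[of "nat (- n)"] False
      by (simp add: absv_inverse power_int_minus)
  qed
qed

text \<open>Discreteness of the value group leaves a gap between 1/p and 1; hence
  \<open>unif\<close> generates the maximal ideal of the valuation ring.\<close>

lemma absv_less_1_iff: "absv x < 1 \<longleftrightarrow> absv x \<le> real p powi (-1)"
proof (cases "x = 0")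
  case False
  then obtain k where "absv x = real p powi k" using absv_value by blast
  then show ?thesis
    using p_powi_less_iff[of k 0] p_powi_le_iff[of k "-1"]
    by (simp del: p_powi_less_iff p_powi_le_iff) linarith
qed (use p_pos in simp)

lemma absv_less_1_dvd:
  assumes "absv x < 1"
  obtains y where "x = unif * y" "absv y \<le> 1"
proof
  show "x = unif * (x / unif)" by simp
  show "absv (x / unif) \<le> 1"
    using assms by (simp add: absv_less_1_iff absv_divide absv_unif divide_le_eq)
qed

section \<open>Lattices and vertices of the tree\<close>

definition O2 :: "('k \<times> 'k) set" where
  "O2 = {(x, y). absv x \<le> 1 \<and> absv y \<le> 1}"

text \<open>This is GL_2(O): a determinant of absolute value 1, rather than merely nonzero, keeps
  the inverse integral.\<close>

definition GLO :: "'k mat2 set" where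
  "GLO = {(a,b,c,d). absv a \<le> 1 \<and> absv b \<le> 1 \<and> absv c \<le> 1 \<and> absv d \<le> 1
            \<and> absv (a * d - b * c) = 1}"

text \<open>The columns of \<open>M\<close> are a basis of the lattice, so vertices are the cosets
  GL_2(K) / K^x GL_2(O), and matrices act by left multiplication.\<close>

definition vtx :: "'k mat2 \<Rightarrow> ('k \<times> 'k) set set" where
  "vtx M = hclass (mat_apply M ` O2)"

lemma O2_iff [simp]: "(x, y) \<in> O2 \<longleftrightarrow> absv x \<le> 1 \<and> absv y \<le> 1"
  by (simp add: O2_def)

lemma GLO_iff: "(a,b,c,d) \<in> GLO \<longleftrightarrow> absv a \<le> 1 \<and> absv b \<le> 1 \<and> absv c \<le> 1 \<and> absv d \<le> 1
            \<and> absv (a * d - b * c) = 1"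
  by (simp add: GLO_def)

lemma GLO_absv_det: "u \<in> GLO \<Longrightarrow> absv (mdet u) = 1"
  by (cases u rule: prod_cases4) (simp add: GLO_iff)

lemma GLO_det: "u \<in> GLO \<Longrightarrow> mdet u \<noteq> 0"
  using GLO_absv_det[of u] by auto

lemma minv_GLO: "u \<in> GLO \<Longrightarrow> minv u \<in> GLO"
proof -
  assume u: "u \<in> GLO"
  have "absv (mdet (minv u)) = 1"
    using u by (simp add: GLO_det GLO_absv_det absv_inverse)
  with u show ?thesis
    using GLO_absv_det[OF u]
    by (cases u rule: prod_cases4) (simp add: minv_def GLO_iff absv_divide)
qed

lemma GLO_O2_subset: "u \<in> GLO \<Longrightarrow> mat_apply u ` O2 \<subseteq> O2"
  by (cases u rule: prod_cases4) (auto simp: GLO_iff intro!: absv_add_le absv_mult_le_one)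

lemma GLO_O2: "u \<in> GLO \<Longrightarrow> mat_apply u ` O2 = O2"
proof (rule antisym[OF GLO_O2_subset])
  assume u: "u \<in> GLO"
  have "O2 = mat_apply u ` (mat_apply (minv u) ` O2)"
    using u by (simp add: GLO_det flip: image_mmul)
  also have "\<dots> \<subseteq> mat_apply u ` O2"
    using GLO_O2_subset[OF minv_GLO[OF u]] by blast
  finally show "O2 \<subseteq> mat_apply u ` O2" .
qed

lemma O2_image_integral:
  assumes "mat_apply (a,b,c,d) ` O2 \<subseteq> O2"
  shows "absv a \<le> 1" "absv b \<le> 1" "absv c \<le> 1" "absv d \<le> 1"
proof -
  have "(a, c) = mat_apply (a,b,c,d) (1, 0)" "(b, d) = mat_apply (a,b,c,d) (0, 1)"
    by simp_all
  then have "(a, c) \<in> O2" "(b, d) \<in> O2"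
    using assms by fastforce+
  then show "absv a \<le> 1" "absv b \<le> 1" "absv c \<le> 1" "absv d \<le> 1"
    by simp_all
qed

lemma O2_image_det: "mat_apply M ` O2 \<subseteq> O2 \<Longrightarrow> absv (mdet M) \<le> 1"
  by (cases M rule: prod_cases4)
     (use O2_image_integral in \<open>auto intro!: absv_diff_le absv_mult_le_one\<close>)

text \<open>If \<open>M\<close> maps the lattice onto itself, so does its inverse; both determinants
  are then integral, hence units.\<close>

lemma GLO_iff_O2:
  assumes "mdet M \<noteq> 0"
  shows "M \<in> GLO \<longleftrightarrow> mat_apply M ` O2 = O2"
proof
  assume eq: "mat_apply M ` O2 = O2"
  have "mat_apply (minv M) ` O2 = mat_apply (minv M) ` (mat_apply M ` O2)"
    by (simp add: eq)
  also have "\<dots> = O2"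
    using assms by (simp flip: image_mmul)
  finally have "absv (mdet (minv M)) \<le> 1" "absv (mdet M) \<le> 1"
    using O2_image_det eq by auto
  moreover have "absv (mdet M) > 0" using assms by simp
  ultimately have "absv (mdet M) = 1"
    using assms by (auto simp: absv_inverse inverse_le_1_iff)
  moreover have "mat_apply M ` O2 \<subseteq> O2" by (simp add: eq)
  ultimately show "M \<in> GLO"
    by (cases M rule: prod_cases4) (simp add: GLO_iff O2_image_integral)
qed (rule GLO_O2)

lemma mmul_GLO: "u \<in> GLO \<Longrightarrow> v \<in> GLO \<Longrightarrow> mmul u v \<in> GLO"
  by (subst GLO_iff_O2) (simp_all add: GLO_det GLO_O2 image_mmul del: mat_apply_mmul)

lemma act_vtx [simp]: "act_vertex M (vtx N) = vtx (mmul M N)"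
  by (simp add: vtx_def act_vertex_hclass image_mmul del: mat_apply_mmul)

lemma vtx_mmul_GLO: "u \<in> GLO \<Longrightarrow> vtx (mmul M u) = vtx M"
  by (simp add: vtx_def image_mmul GLO_O2 del: mat_apply_mmul)

lemma vtx_mmul_scalar: "c \<noteq> 0 \<Longrightarrow> vtx (mmul (mdiag c c) M) = vtx M"
  unfolding vtx_def image_mmul scal_eq_image[symmetric] by (rule hclass_scal)

text \<open>Scalars and \<open>GLO\<close> generate the stabilizer of the class of
  \<open>O2\<close>. Every equality of vertices is turned into a matrix equation in this
  way.\<close>

lemma vtx_eq_iff:
  assumes M: "mdet M \<noteq> 0" and N: "mdet N \<noteq> 0"
  shows "vtx M = vtx N \<longleftrightarrow> (\<exists>c u. c \<noteq> 0 \<and> u \<in> GLO \<and> N = mmul (mdiag c c) (mmul M u))"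
proof
  assume "vtx M = vtx N"
  then have "mat_apply N ` O2 \<in> hclass (mat_apply M ` O2)"
    unfolding vtx_def using hclass_self by metis
  then obtain c where c: "c \<noteq> 0" and eq: "mat_apply N ` O2 = scal c (mat_apply M ` O2)"
    by (auto simp: hclass_def)
  define u where "u = mmul (minv (mmul (mdiag c c) M)) N"
  have cM: "mdet (mmul (mdiag c c) M) \<noteq> 0" using c M by simp
  then have N_eq: "N = mmul (mmul (mdiag c c) M) u"
    unfolding u_def using minv_cancel(1)[OF cM, of N] by simp
  have "mat_apply u ` O2 = mat_apply (minv (mmul (mdiag c c) M)) ` (mat_apply N ` O2)"
    unfolding u_def by (simp only: image_mmul)
  also have "\<dots> = mat_apply (minv (mmul (mdiag c c) M)) ` (mat_apply (mmul (mdiag c c) M) ` O2)"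
    unfolding eq scal_eq_image image_mmul ..
  also have "\<dots> = O2"
    unfolding image_mmul[symmetric] minv_left[OF cM] by simp
  finally have "u \<in> GLO"
    using N N_eq by (subst GLO_iff_O2) auto
  with c N_eq show "\<exists>c u. c \<noteq> 0 \<and> u \<in> GLO \<and> N = mmul (mdiag c c) (mmul M u)"
    unfolding mmul_assoc by blast
qed (auto simp: vtx_mmul_GLO vtx_mmul_scalar)

lemma is_lattice_iff: "is_lattice absv L \<longleftrightarrow> (\<exists>M. mdet M \<noteq> 0 \<and> L = mat_apply M ` O2)"
proof -
  have eq: "{(a*u1 + b*w1, a*u2 + b*w2) | a b. absv a \<le> 1 \<and> absv b \<le> 1}
        = mat_apply (u1,w1,u2,w2) ` O2" for u1 u2 w1 w2
    by (force simp: O2_def mult.commute image_def)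
  have det: "u1*w2 - u2*w1 = mdet (u1,w1,u2,w2)" for u1 u2 w1 w2
    by (simp add: mult.commute)
  show ?thesis
    unfolding is_lattice_def eq det by (metis prod_cases4)
qed

lemma tree_vertices_iff: "v \<in> tree_vertices absv \<longleftrightarrow> (\<exists>M. mdet M \<noteq> 0 \<and> v = vtx M)"
  unfolding tree_vertices_def is_lattice_iff vtx_def by blast

lemma std_vertex_eq: "std_vertex p absv n = vtx (mdiag 1 (unif powi n))"
proof -
  have "{(a, (of_nat p) powi n * b) | a b. absv a \<le> 1 \<and> absv b \<le> 1}
      = mat_apply (mdiag 1 (unif powi n)) ` O2"
    by (force simp: O2_def mdiag_def unif_def image_def)
  then show ?thesis
    by (simp add: std_vertex_def vtx_def)
qed

lemma integral_O2_subset: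
  assumes "absv a \<le> 1" "absv b \<le> 1" "absv c \<le> 1" "absv d \<le> 1"
  shows "mat_apply (a,b,c,d) ` O2 \<subseteq> O2"
  using assms by (auto intro!: absv_add_le absv_mult_le_one)

lemma columns_in_lattice:
  assumes "(a, c) \<in> mat_apply K ` O2" "(b, d) \<in> mat_apply K ` O2"
  shows "mat_apply (a,b,c,d) ` O2 \<subseteq> mat_apply K ` O2"
proof -
  obtain s t s' t' where st: "(a, c) = mat_apply K (s, t)" "(b, d) = mat_apply K (s', t')"
    and int: "absv s \<le> 1" "absv t \<le> 1" "absv s' \<le> 1" "absv t' \<le> 1"
    using assms by auto
  have "(a,b,c,d) = mmul K (s,s',t,t')"
    using st by (cases K rule: prod_cases4) simp
  then have "mat_apply (a,b,c,d) ` O2 = mat_apply K ` (mat_apply (s,s',t,t') ` O2)"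
    by (simp only: image_mmul)
  then show ?thesis
    using integral_O2_subset[OF int(1,3,2,4)] by blast
qed

text \<open>Elementary divisors of an intermediate lattice. A vector of it outside p
  \<open>O2\<close> is primitive, so it is the first column of some \<open>u\<close> in
  \<open>GLO\<close>; p times the second column lies in the lattice by the lower inclusion, and
  strictness of the upper one excludes anything more.\<close>

lemma sublattice_normal_form:
  assumes lower: "scal unif O2 \<subset> mat_apply K ` O2" and upper: "mat_apply K ` O2 \<subset> O2"
  obtains u where "u \<in> GLO" "mat_apply K ` O2 = mat_apply (mmul u (mdiag 1 unif)) ` O2"
proof -
  let ?N = "mat_apply K ` O2"
  obtain x1 x2 where x: "(x1, x2) \<in> ?N" "(x1, x2) \<notin> scal unif O2"
    using lower by auto
  then have x_int: "absv x1 \<le> 1" "absv x2 \<le> 1"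
    using upper O2_iff by blast+
  have "absv x1 = 1 \<or> absv x2 = 1"
  proof (rule ccontr)
    assume "\<not> ?thesis"
    then have "absv x1 < 1" "absv x2 < 1" using x_int by auto
    then obtain y1 y2 where "x1 = unif * y1" "absv y1 \<le> 1" "x2 = unif * y2" "absv y2 \<le> 1"
      using absv_less_1_dvd by metis
    then have "(x1, x2) \<in> scal unif O2"
      unfolding scal_def by (intro image_eqI[of _ _ "(y1, y2)"]) auto
    with x show False by simp
  qed
  then have "\<exists>e1 e2. (x1, e1, x2, e2) \<in> GLO"
  proof
    assume "absv x1 = 1"
    then have "(x1, 0, x2, 1) \<in> GLO" using x_int by (simp add: GLO_iff)
    then show ?thesis by blast
  next
    assume "absv x2 = 1"
    then have "(x1, 1, x2, 0) \<in> GLO" using x_int by (simp add: GLO_iff)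
    then show ?thesis by blast
  qed
  then obtain e1 e2 where u: "(x1, e1, x2, e2) \<in> GLO" by blast
  let ?u = "(x1, e1, x2, e2)"
  have "?N = mat_apply (mmul ?u (mdiag 1 unif)) ` O2"
  proof
    have "(unif * e1, unif * e2) \<in> scal unif O2"
      using u unfolding scal_def by (intro image_eqI[of _ _ "(e1, e2)"]) (auto simp: GLO_iff)
    then have "(e1 * unif, e2 * unif) \<in> ?N"
      using lower by (auto simp: mult.commute)
    then have "mat_apply (x1, e1 * unif, x2, e2 * unif) ` O2 \<subseteq> ?N"
      using columns_in_lattice x by blast
    then show "mat_apply (mmul ?u (mdiag 1 unif)) ` O2 \<subseteq> ?N"
      by (simp add: mdiag_def)
  next
    show "?N \<subseteq> mat_apply (mmul ?u (mdiag 1 unif)) ` O2"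
    proof
      fix y assume y: "y \<in> ?N"
      then have "y \<in> mat_apply ?u ` O2"
        using upper GLO_O2[OF u] by blast
      then obtain a b where ab: "y = mat_apply ?u (a, b)" "absv a \<le> 1" "absv b \<le> 1"
        by auto
      \<comment> \<open>With a unit \<open>b\<close>, the primitive vector and \<open>y\<close>
        would form a basis of \<open>O2\<close> inside the sublattice.\<close>
      have "absv b \<noteq> 1"
      proof
        assume b: "absv b = 1"
        have "(1, a, 0, b) \<in> GLO" using ab b by (simp add: GLO_iff)
        then have "mmul ?u (1, a, 0, b) \<in> GLO" by (rule mmul_GLO[OF u])
        then have "mat_apply (mmul ?u (1, a, 0, b)) ` O2 = O2" by (rule GLO_O2)
        moreover have "mat_apply (mmul ?u (1, a, 0, b)) ` O2 \<subseteq> ?N"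
          using columns_in_lattice[OF x(1), of "x1 * a + e1 * b" "x2 * a + e2 * b"] y ab by simp
        ultimately show False using upper by simp
      qed
      then obtain b' where b': "b = unif * b'" "absv b' \<le> 1"
        using ab absv_less_1_dvd[of b] by force
      then have "y = mat_apply (mmul ?u (mdiag 1 unif)) (a, b')"
        using ab by (simp add: mdiag_def algebra_simps)
      then show "y \<in> mat_apply (mmul ?u (mdiag 1 unif)) ` O2"
        by (rule image_eqI) (use ab b' in simp)
    qed
  qed
  with u show thesis by (rule that)
qed

lemma inj_mat_apply: "mdet M \<noteq> 0 \<Longrightarrow> inj (mat_apply M)"
  by (metis injI mat_apply_mmul mat_apply_mone minv_left)

lemma std_neighbour_strict:
  "scal unif O2 \<subset> mat_apply (mdiag 1 unif) ` O2" "mat_apply (mdiag 1 unif) ` O2 \<subset> O2"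
proof -
  have dvd: "absv y < 1 \<longleftrightarrow> (\<exists>z. y = unif * z \<and> absv z \<le> 1)" for y
  proof
    assume "\<exists>z. y = unif * z \<and> absv z \<le> 1"
    then show "absv y < 1"
      unfolding absv_less_1_iff by (auto simp: absv_mult absv_unif mult_left_le)
  qed (use absv_less_1_dvd in blast)
  have mem: "(x, y) \<in> mat_apply (mdiag 1 unif) ` O2 \<longleftrightarrow> absv x \<le> 1 \<and> absv y < 1" for x y
    unfolding dvd by (auto simp: mdiag_def image_iff O2_def)
  have mem': "(x, y) \<in> scal unif O2 \<longleftrightarrow> absv x < 1 \<and> absv y < 1" for x y
    unfolding dvd by (auto simp: scal_def image_iff O2_def)
  show "scal unif O2 \<subset> mat_apply (mdiag 1 unif) ` O2"
  proof (rule psubsetI)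
    show "scal unif O2 \<subseteq> mat_apply (mdiag 1 unif) ` O2"
      using mem mem' by (auto simp: less_imp_le)
    have "(1, 0) \<in> mat_apply (mdiag 1 unif) ` O2" "(1, 0) \<notin> scal unif O2"
      unfolding mem mem' by auto
    then show "scal unif O2 \<noteq> mat_apply (mdiag 1 unif) ` O2" by metis
  qed
  show "mat_apply (mdiag 1 unif) ` O2 \<subset> O2"
  proof (rule psubsetI)
    show "mat_apply (mdiag 1 unif) ` O2 \<subseteq> O2"
      unfolding mdiag_def by (rule integral_O2_subset) (use dvd[of unif] in \<open>auto intro!: less_imp_le\<close>)
    have "(0, 1) \<notin> mat_apply (mdiag 1 unif) ` O2" "(0, 1) \<in> O2"
      unfolding mem by auto
    then show "mat_apply (mdiag 1 unif) ` O2 \<noteq> O2" by metis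
  qed
qed

text \<open>A basis of the larger lattice moves the pair to the normal form above, so GL_2(K) is
  transitive on oriented edges, with the one from vertex 0 to vertex 1 of the standard apartment as
  base point.\<close>

lemma tree_adj_iff:
  "tree_adj p absv v w \<longleftrightarrow>
     (\<exists>M. mdet M \<noteq> 0 \<and> v = vtx M \<and> w = vtx (mmul M (mdiag 1 unif)))"
proof
  assume adj: "tree_adj p absv v w"
  then obtain L L' where L: "L \<in> v" "L' \<in> w" "scal unif L \<subset> L'" "L' \<subset> L"
    unfolding tree_adj_def unif_def by blast
  have lattice: "\<exists>M. mdet M \<noteq> 0 \<and> L = mat_apply M ` O2 \<and> v = vtx M"
    if "v \<in> tree_vertices absv" "L \<in> v" for v L
  proof -
    obtain M where M: "mdet M \<noteq> 0" "v = vtx M" using \<open>v \<in> _\<close> tree_vertices_iff by blast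
    then obtain c where "c \<noteq> 0" "L = scal c (mat_apply M ` O2)"
      using \<open>L \<in> v\<close> by (auto simp: vtx_def hclass_def)
    then show ?thesis
      using M by (intro exI[of _ "mmul (mdiag c c) M"])
        (auto simp: vtx_mmul_scalar scal_eq_image image_mmul simp del: mat_apply_mmul)
  qed
  obtain M where M: "mdet M \<noteq> 0" "L = mat_apply M ` O2" "v = vtx M"
    using lattice[of v L] adj L unfolding tree_adj_def by blast
  obtain M' where M': "mdet M' \<noteq> 0" "L' = mat_apply M' ` O2" "w = vtx M'"
    using lattice[of w L'] adj L unfolding tree_adj_def by blast
  \<comment> \<open>The coordinates of a basis of \<open>L'\<close> with respect to the basis
    \<open>M\<close> of \<open>L\<close>.\<close>
  let ?K = "mmul (minv M) M'"
  have inj: "inj (mat_apply (minv M))"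
    using M by (intro inj_mat_apply) simp
  have "mat_apply (minv M) ` scal unif L \<subset> mat_apply (minv M) ` L'"
    "mat_apply (minv M) ` L' \<subset> mat_apply (minv M) ` L"
    using L inj_on_subset[OF inj subset_UNIV] by (auto intro!: image_strict_mono)
  moreover have "mat_apply (minv M) ` scal unif L = scal unif O2"
    unfolding scal_eq_image M image_mmul[symmetric] mscalar_commute[of unif]
      mmul_assoc[symmetric] minv_left[OF M(1)] by simp
  moreover have "mat_apply (minv M) ` L = O2"
    unfolding M image_mmul[symmetric] minv_left[OF M(1)] by simp
  moreover have "mat_apply (minv M) ` L' = mat_apply ?K ` O2"
    unfolding M' image_mmul ..
  ultimately have strict: "scal unif O2 \<subset> mat_apply ?K ` O2" "mat_apply ?K ` O2 \<subset> O2"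
    by simp_all
  obtain u where u: "u \<in> GLO" "mat_apply ?K ` O2 = mat_apply (mmul u (mdiag 1 unif)) ` O2"
    using sublattice_normal_form[OF strict] by blast
  have "mat_apply M ` (mat_apply ?K ` O2) = mat_apply M ` (mat_apply (mmul u (mdiag 1 unif)) ` O2)"
    by (simp only: u(2))
  then have "mat_apply M' ` O2 = mat_apply (mmul (mmul M u) (mdiag 1 unif)) ` O2"
    unfolding image_mmul[symmetric] using M(1) by (simp add: mmul_assoc)
  then have "w = vtx (mmul (mmul M u) (mdiag 1 unif))" "v = vtx (mmul M u)"
    unfolding M M' vtx_mmul_GLO[OF u(1)] by (simp_all only: vtx_def)
  then show "\<exists>M. mdet M \<noteq> 0 \<and> v = vtx M \<and> w = vtx (mmul M (mdiag 1 unif))"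
    using M(1) u(1) by (intro exI[of _ "mmul M u"]) (auto simp: GLO_det)
next
  assume "\<exists>M. mdet M \<noteq> 0 \<and> v = vtx M \<and> w = vtx (mmul M (mdiag 1 unif))"
  then obtain M where M: "mdet M \<noteq> 0" "v = vtx M" "w = vtx (mmul M (mdiag 1 unif))"
    by blast
  let ?L = "mat_apply M ` O2" and ?L' = "mat_apply (mmul M (mdiag 1 unif)) ` O2"
  have eq: "scal unif ?L = mat_apply M ` scal unif O2"
    unfolding scal_eq_image image_mmul[symmetric] mscalar_commute[of unif] ..
  have "scal unif ?L \<subset> ?L'" "?L' \<subset> ?L"
    unfolding eq image_mmul using std_neighbour_strict inj_on_subset[OF inj_mat_apply[OF M(1)] subset_UNIV]
    by (auto intro!: image_strict_mono)
  moreover have "?L \<in> v" "?L' \<in> w"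
    unfolding M vtx_def by (rule hclass_self)+
  moreover have "v \<in> tree_vertices absv" "w \<in> tree_vertices absv"
    unfolding tree_vertices_iff M
    by (rule exI[of _ M], use M in simp, rule exI[of _ "mmul M (mdiag 1 unif)"], use M in simp)
  ultimately show "tree_adj p absv v w"
    unfolding tree_adj_def unif_def by blast
qed

section \<open>The standard apartment and geodesics\<close>

abbreviation std :: "int \<Rightarrow> ('k \<times> 'k) set set" where
  "std \<equiv> std_vertex p absv"

lemma vtx_std: "vtx (mmul M (mdiag 1 (unif powi n))) = act_vertex M (std n)"
  by (simp add: std_vertex_eq)

lemma unif_powi_add: "unif powi (m + n) = unif powi m * unif powi n"
  by (rule power_int_add) simp

lemma tree_adj_act:
  assumes "mdet g \<noteq> 0"
  shows "tree_adj p absv (act_vertex g v) (act_vertex g w) \<longleftrightarrow> tree_adj p absv v w"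
proof -
  have *: "tree_adj p absv (act_vertex g v) (act_vertex g w)"
    if g: "mdet g \<noteq> 0" and vw: "tree_adj p absv v w" for g v w
  proof -
    obtain M where "mdet M \<noteq> 0" "v = vtx M" "w = vtx (mmul M (mdiag 1 unif))"
      using vw unfolding tree_adj_iff by blast
    with g show ?thesis
      unfolding tree_adj_iff by (intro exI[of _ "mmul g M"]) (simp add: mmul_assoc)
  qed
  show ?thesis
    using *[OF assms, of v w] *[of "minv g" "act_vertex g v" "act_vertex g w"] assms
      act_vertex_inverse(1)[OF assms] by auto
qed

lemma std_adj_Suc: "tree_adj p absv (std n) (std (n + 1))"
  unfolding tree_adj_iff std_vertex_eq
  by (intro exI[of _ "mdiag 1 (unif powi n)"]) (simp add: unif_powi_add)

text \<open>The relative position \<open>W\<close> is integral with determinant of absolute value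
  1/p. Since both vertices are standard, its entry \<open>b\<close> vanishes, so the diagonal
  entries have absolute values p^x and p^y with x + y = -1 and x, y \<le> 0: two cases, one for each
  neighbour.\<close>

lemma std_adj_imp: "tree_adj p absv (std i) (std j) \<Longrightarrow> j = i + 1 \<or> j = i - 1"
proof -
  assume "tree_adj p absv (std i) (std j)"
  then obtain K where K: "mdet K \<noteq> 0" "vtx (mdiag 1 (unif powi i)) = vtx K"
      "vtx (mdiag 1 (unif powi j)) = vtx (mmul K (mdiag 1 unif))"
    unfolding tree_adj_iff std_vertex_eq by blast
  obtain c u where u: "u \<in> GLO" "K = mmul (mdiag c c) (mmul (mdiag 1 (unif powi i)) u)"
    using iffD1[OF vtx_eq_iff[OF _ K(1)] K(2)] by auto
  have "mdet (mmul K (mdiag 1 unif)) \<noteq> 0" "mdet (mdiag 1 (unif powi j)) \<noteq> 0"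
    using K(1) by simp_all
  then obtain c' u' where u': "u' \<in> GLO"
      "mdiag 1 (unif powi j) = mmul (mdiag c' c') (mmul (mmul K (mdiag 1 unif)) u')"
    using iffD1[OF vtx_eq_iff K(3)[symmetric]] by blast
  define W where "W = mmul u (mmul (mdiag 1 unif) u')"
  obtain a b c0 d where W: "W = (a,b,c0,d)" by (cases W rule: prod_cases4)
  have "mat_apply W ` O2 = mat_apply u ` (mat_apply (mdiag 1 unif) ` O2)"
    unfolding W_def image_mmul by (simp only: GLO_O2[OF u'(1)])
  also have "\<dots> \<subseteq> mat_apply u ` O2"
    using std_neighbour_strict(2) by blast
  also have "\<dots> = O2" by (rule GLO_O2[OF u(1)])
  finally have int: "absv a \<le> 1" "absv d \<le> 1"
    unfolding W by (rule O2_image_integral)+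
  have "absv (mdet W) = real p powi (-1)"
    using u(1) u'(1) by (simp add: W_def absv_mult GLO_absv_det absv_unif)
  define \<nu> where "\<nu> = c' * c"
  have "mdiag 1 (unif powi j) = mmul (mdiag c' c') (mmul (mdiag c c) (mmul (mdiag 1 (unif powi i)) W))"
    unfolding u'(2) u(2) W_def by (simp only: mmul_assoc)
  also have "\<dots> = mmul (mdiag \<nu> (\<nu> * unif powi i)) W"
    by (simp add: \<nu>_def mult.assoc flip: mmul_assoc)
  finally have eqs: "\<nu> * a = 1" "\<nu> * b = 0" "unif powi j = \<nu> * unif powi i * d"
    by (simp_all add: W mdiag_def)
  then have "a \<noteq> 0" "b = 0" "d \<noteq> 0" by auto
  then have "\<nu> = inverse a" using eqs(1) by (simp add: field_simps)
  obtain x where x: "absv a = real p powi x" by (rule absv_value[OF \<open>a \<noteq> 0\<close>])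
  obtain y where y: "absv d = real p powi y" by (rule absv_value[OF \<open>d \<noteq> 0\<close>])
  note xy = x y
  have "real p powi (x + y) = real p powi (-1)"
    using \<open>absv (mdet W) = _\<close> \<open>b = 0\<close> xy by (simp add: W absv_mult p_powi_add del: p_powi_eq_iff)
  then have "x + y = -1" by (simp only: p_powi_eq_iff)
  moreover have "x \<le> 0" "y \<le> 0" using int xy by simp_all
  moreover have "absv (unif powi j) = absv (\<nu> * unif powi i * d)" using eqs by simp
  then have "real p powi (- j) = real p powi (- x + - i + y)"
    unfolding absv_mult \<open>\<nu> = inverse a\<close> absv_inverse xy absv_unif_powi p_powi_add
    by (simp only: power_int_minus)
  then have "- j = - x + - i + y" by (simp only: p_powi_eq_iff)
  ultimately show ?thesis by arith
qed

text \<open>Comparing determinants, to which \<open>u\<close> contributes absolute value 1, ties the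
  size of the scalar \<open>c\<close> to the displacement \<open>m - n\<close>.\<close>

lemma act_std_std:
  assumes T: "mdet T \<noteq> 0" "act_vertex T (std n) = std m"
  obtains c u where "c \<noteq> 0" "u \<in> GLO"
    "mmul T (mdiag 1 (unif powi n)) = mmul (mdiag c (c * unif powi m)) u"
    "absv c ^ 2 * real p powi (- m) = absv (mdet T) * real p powi (- n)"
proof -
  have "vtx (mdiag 1 (unif powi m)) = vtx (mmul T (mdiag 1 (unif powi n)))"
    using T by (simp add: std_vertex_eq)
  then obtain c u where c: "c \<noteq> 0" "u \<in> GLO"
    and "mmul T (mdiag 1 (unif powi n)) = mmul (mdiag c c) (mmul (mdiag 1 (unif powi m)) u)"
    using T by (subst (asm) vtx_eq_iff) auto
  then have eq: "mmul T (mdiag 1 (unif powi n)) = mmul (mdiag c (c * unif powi m)) u"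
    by (simp flip: mmul_assoc)
  then have "absv (mdet (mmul T (mdiag 1 (unif powi n)))) = absv (mdet (mmul (mdiag c (c * unif powi m)) u))"
    by simp
  then have "absv c ^ 2 * real p powi (- m) = absv (mdet T) * real p powi (- n)"
    by (simp add: absv_mult GLO_absv_det[OF c(2)] power2_eq_square)
  with c eq that show thesis by blast
qed

text \<open>The matrix is \<nu> diag(1, p^m) u diag(1, p^(-n)) with integral u, so \<open>a\<close>
  is \<nu> and \<open>d\<close> is \<nu> p^(m-n) times an integral entry; determinant 1 gives \<nu>
  the squared absolute value p^(m-n).\<close>

lemma act_std_diagonal_bound:
  assumes T: "mdet (a,b,c,d) = 1" "act_vertex (a,b,c,d) (std n) = std m"
  shows "absv a ^ 2 \<le> real p powi (m - n)" "absv d ^ 2 \<le> real p powi (n - m)"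
proof -
  have nz: "mdet (a,b,c,d) \<noteq> 0" unfolding T(1) by simp
  obtain \<nu> u where u: "\<nu> \<noteq> 0" "u \<in> GLO"
      "mmul (a,b,c,d) (mdiag 1 (unif powi n)) = mmul (mdiag \<nu> (\<nu> * unif powi m)) u"
      "absv \<nu> ^ 2 * real p powi (- m) = absv (mdet (a,b,c,d)) * real p powi (- n)"
    using act_std_std[OF nz T(2)] by blast
  obtain u1 u2 u3 u4 where u_eq: "u = (u1,u2,u3,u4)" by (cases u rule: prod_cases4)
  have eqs: "a = \<nu> * u1" "d * unif powi n = \<nu> * unif powi m * u4"
    using u(3) by (simp_all add: u_eq mdiag_def)
  have int: "absv u1 \<le> 1" "absv u4 \<le> 1" using u(2) by (simp_all add: u_eq GLO_iff)
  have "real p powi (- m) \<noteq> 0"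
    using prime_gt_0_nat[OF prime] by simp
  moreover have "real p powi (m - n) * real p powi (- m) = real p powi (- n)"
    by (simp flip: p_powi_add)
  then have "absv \<nu> ^ 2 * real p powi (- m) = real p powi (m - n) * real p powi (- m)"
    using u(4) unfolding T(1) by simp
  ultimately have \<nu>: "absv \<nu> ^ 2 = real p powi (m - n)"
    using mult_right_cancel by blast
  have "absv a ^ 2 \<le> absv \<nu> ^ 2"
    unfolding eqs absv_mult using int(1) by (intro power_mono) (simp_all add: mult_left_le)
  then show "absv a ^ 2 \<le> real p powi (m - n)" using \<nu> by simp
  have "d = \<nu> * unif powi (m - n) * u4"
    using eqs(2) by (simp add: power_int_diff field_simps)
  then have "absv d \<le> absv \<nu> * real p powi (n - m)"
    using int(2) by (simp add: absv_mult mult_left_le)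
  then have "absv d ^ 2 \<le> (absv \<nu> * real p powi (n - m)) ^ 2"
    by (intro power_mono) simp_all
  also have "\<dots> = real p powi ((m - n) + (n - m) + (n - m))"
    unfolding power_mult_distrib \<nu> by (simp add: power2_eq_square flip: p_powi_add)
  finally show "absv d ^ 2 \<le> real p powi (n - m)" by simp
qed

text \<open>Conjugation by \<open>h\<close> keeps the trace and leads to the standard apartment.
  There the way from \<open>n\<close> to \<open>m\<close> bounds the entry \<open>d\<close>, and the
  way back bounds \<open>a\<close>. The bound is of interest for n < m.\<close>

lemma swap_trace_bound:
  assumes "mdet g = 1" "mdet h \<noteq> 0"
    and "act_vertex g (act_vertex h (std n)) = act_vertex h (std m)"
    and "act_vertex g (act_vertex h (std m)) = act_vertex h (std n)"
  shows "absv (mtrace g) ^ 2 \<le> real p powi (n - m)"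
proof -
  define T where "T = mmul (minv h) (mmul g h)"
  have "mdet T = 1"
    using assms(1,2) by (simp add: T_def)
  moreover have "act_vertex T (std n) = std m" "act_vertex T (std m) = std n"
    using assms by (simp_all add: T_def act_vertex_mmul act_vertex_inverse)
  moreover obtain a b c d where T: "T = (a,b,c,d)" by (cases T rule: prod_cases4)
  ultimately have "absv a ^ 2 \<le> real p powi (n - m)" "absv d ^ 2 \<le> real p powi (n - m)"
    using act_std_diagonal_bound by blast+
  moreover have "mtrace g = mtrace T"
    using assms(2) by (simp add: T_def mtrace_mmul_commute[of "minv h"] mmul_assoc)
  then have "absv (mtrace g) \<le> max (absv a) (absv d)"
    using absv_add by (simp add: T)
  then have "absv (mtrace g) ^ 2 \<le> max (absv a ^ 2) (absv d ^ 2)"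
    by (simp add: max_def power_mono split: if_splits)
  ultimately show ?thesis by linarith
qed

text \<open>The parity of the index is the type of a vertex; determinant 1 makes
  \<open>m - n\<close> twice the exponent of the scalar in \<open>act_std_std\<close>.\<close>

lemma std_type:
  assumes "mdet g = 1" "mdet h \<noteq> 0" "act_vertex g (act_vertex h (std n)) = act_vertex h (std m)"
  shows "even (m - n)"
proof -
  define T where "T = mmul (minv h) (mmul g h)"
  have T: "mdet T = 1" "act_vertex T (std n) = std m"
    using assms by (simp_all add: T_def act_vertex_mmul act_vertex_inverse)
  then obtain c u where c: "c \<noteq> 0" "absv c ^ 2 * real p powi (- m) = absv (mdet T) * real p powi (- n)"
    using act_std_std[of T n m] by auto
  obtain k where "absv c = real p powi k" using absv_value[OF c(1)] by blast
  then have "real p powi (k + k + - m) = real p powi (- n)"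
    using c(2) unfolding p_powi_add T power2_eq_square by simp
  then have "2 * k - m = - n" by simp
  then show ?thesis by presburger
qed

text \<open>The diagonal bounds, applied to the identity matrix, make both differences of the
  indices nonnegative.\<close>

lemma inj_std: "inj std"
proof (rule injI)
  fix n m assume eq: "std n = std m"
  have "absv 1 ^ 2 \<le> real p powi (m - n)" "absv 1 ^ 2 \<le> real p powi (n - m)"
    by (rule act_std_diagonal_bound[of 1 0 0 1]; use eq in \<open>simp flip: mdiag_def\<close>)+
  then show "n = m" by simp
qed

text \<open>A neighbour other than the vertex n - 1 arises from the vertex n + 1 by a lower
  unipotent matrix, and this matrix can be chosen to fix all vertices up to n.\<close>

lemma extend_by_adjacent:
  assumes M: "mdet M \<noteq> 0" and adj: "tree_adj p absv (act_vertex M (std n)) w"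
    and turn: "w \<noteq> act_vertex M (std (n - 1))"
  obtains M' where "mdet M' \<noteq> 0" "w = act_vertex M' (std (n + 1))"
    "\<And>j. j \<le> n \<Longrightarrow> act_vertex M' (std j) = act_vertex M (std j)"
proof -
  let ?D = "\<lambda>n. mdiag 1 (unif powi n)"
  obtain K where K: "mdet K \<noteq> 0" "vtx (mmul M (?D n)) = vtx K" "w = vtx (mmul K (mdiag 1 unif))"
    using adj unfolding tree_adj_iff by (auto simp: std_vertex_eq)
  then obtain c u where c: "c \<noteq> 0" and u: "u \<in> GLO" and "K = mmul (mdiag c c) (mmul (mmul M (?D n)) u)"
    using M by (subst (asm) vtx_eq_iff) auto
  then have w: "w = vtx (mmul (mmul M (?D n)) (mmul u (mdiag 1 unif)))"
    using K by (simp add: mmul_assoc vtx_mmul_scalar)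
  obtain a b e d where u_eq: "u = (a,b,e,d)" by (cases u rule: prod_cases4)
  \<comment> \<open>A non-unit \<open>a\<close> yields the neighbour n - 1, which
    \<open>turn\<close> excludes.\<close>
  have a1: "absv a = 1"
  proof (rule ccontr)
    assume "absv a \<noteq> 1"
    then have "absv a < 1" using u by (simp add: u_eq GLO_iff)
    then obtain a' where a': "a = unif * a'" "absv a' \<le> 1" by (rule absv_less_1_dvd)
    have absv_unif_le: "absv unif \<le> 1" using absv_less_1_iff[of unif] absv_unif by simp
    \<comment> \<open>The factor p of the first row is pulled out to the left; what remains has the
      determinant of \<open>u\<close>.\<close>
    define u' :: "'k mat2" where "u' = (a', b, e, unif * d)"
    have "u' \<in> GLO"
      using u a' absv_mult_le_one[OF absv_unif_le, of d] by (simp add: u_eq u'_def GLO_iff mult.commute mult.left_commute)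
    have "mmul u (mdiag 1 unif) = mmul (mdiag unif 1) u'"
      by (simp add: u_eq u'_def mdiag_def a' mult.commute)
    then have "mmul (mmul M (?D n)) (mmul u (mdiag 1 unif))
        = mmul (mmul M (mmul (?D n) (mdiag unif 1))) u'"
      by (simp only: mmul_assoc)
    also have "mmul (?D n) (mdiag unif 1) = mmul (mdiag unif unif) (?D (n - 1))"
      using unif_powi_add[of "n - 1" 1] by (simp add: mult.commute)
    also have "mmul (mmul M (mmul (mdiag unif unif) (?D (n - 1)))) u'
        = mmul (mdiag unif unif) (mmul (mmul M (?D (n - 1))) u')"
      by (simp only: mscalar_commute[of unif M] flip: mmul_assoc)
    finally have "mmul (mmul M (?D n)) (mmul u (mdiag 1 unif))
        = mmul (mdiag unif unif) (mmul (mmul M (?D (n - 1))) u')" .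
    then have "w = vtx (mmul M (?D (n - 1)))"
      unfolding w using \<open>u' \<in> GLO\<close> by (simp add: vtx_mmul_scalar vtx_mmul_GLO)
    with turn show False by (simp add: vtx_std)
  qed
  then have [simp]: "a \<noteq> 0" by auto
  define y where "y = e / a"
  have y: "absv y \<le> 1" using u a1 by (simp add: y_def absv_divide u_eq GLO_iff)
  \<comment> \<open>The conjugate of (1, 0, y, 1) by diag(1, p^n), which does at the vertex n what
    (1, 0, y, 1) does at the vertex 0.\<close>
  define L :: "'k mat2" where "L = (1, 0, y * unif powi n, 1)"
  have L: "mmul L (?D n) = mmul (?D n) (1, 0, y, 1)"
    by (simp add: L_def mdiag_def mult.commute)
  define M' where "M' = mmul M L"
  show thesis
  proof
    show "mdet M' \<noteq> 0" using M by (simp add: M'_def L_def)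
    \<comment> \<open>The upper triangular factor left when (1, 0, y, 1) is split off
      \<open>u\<close>, conjugated past diag(1, p); it stays in \<open>GLO\<close>.\<close>
    define u' :: "'k mat2" where "u' = (a, unif * b, 0, d - b * e / a)"
    have "a * (d - b * e / a) = a * d - b * e" by (simp add: field_simps)
    moreover from this have "absv (d - b * e / a) = absv (a * d - b * e)"
      using a1 absv_mult[of a "d - b * e / a"] by simp
    moreover have "absv unif \<le> 1" using absv_less_1_iff[of unif] absv_unif by simp
    ultimately have "u' \<in> GLO"
      using u by (simp add: u_eq u'_def GLO_iff absv_mult_le_one)
    have "mmul u (mdiag 1 unif) = mmul (mmul (1, 0, y, 1) (mdiag 1 unif)) u'"
      by (simp add: u_eq u'_def y_def mdiag_def field_simps)
    then have "mmul (mmul M (?D n)) (mmul u (mdiag 1 unif)) = mmul (mmul M (mmul (mmul (?D n) (1, 0, y, 1)) (mdiag 1 unif))) u'"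
      by (simp only: mmul_assoc)
    also have "\<dots> = mmul (mmul M' (mmul (?D n) (mdiag 1 unif))) u'"
      unfolding L[symmetric] M'_def by (simp only: mmul_assoc)
    also have "mmul (?D n) (mdiag 1 unif) = ?D (n + 1)"
      by (simp add: unif_powi_add)
    finally have "mmul (mmul M (?D n)) (mmul u (mdiag 1 unif)) = mmul (mmul M' (?D (n + 1))) u'" .
    then show "w = act_vertex M' (std (n + 1))"
      unfolding w vtx_std[symmetric] using \<open>u' \<in> GLO\<close> by (simp add: vtx_mmul_GLO)
  next
    fix j assume "j \<le> n"
    have "mmul L (?D j) = mmul (?D j) (1, 0, y * unif powi (n - j), 1)"
      by (simp add: L_def mdiag_def power_int_diff)
    moreover have "(1, 0, y * unif powi (n - j), 1) \<in> GLO"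
      using y \<open>j \<le> n\<close> by (simp add: GLO_iff absv_mult mult_le_one)
    ultimately have "vtx (mmul M (mmul L (?D j))) = vtx (mmul M (?D j))"
      by (simp only: vtx_mmul_GLO flip: mmul_assoc)
    then show "act_vertex M' (std j) = act_vertex M (std j)"
      unfolding vtx_std[symmetric] M'_def mmul_assoc .
  qed
qed

text \<open>Absence of backtracking is local, yet it straightens initial pieces of every length,
  because each extension leaves the vertices already placed untouched. The induction starts with an
  edge, as a turn involves two earlier vertices.\<close>

lemma nonbacktracking_path_standard:
  fixes f :: "nat \<Rightarrow> ('k \<times> 'k) set set"
  assumes adj: "\<And>i. tree_adj p absv (f i) (f (Suc i))" and turn: "\<And>i. f (Suc (Suc i)) \<noteq> f i"
  shows "\<exists>M. mdet M \<noteq> 0 \<and> (\<forall>j\<le>Suc m. f j = act_vertex M (std (int j)))"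
proof (induction m)
  case 0
  obtain M where M: "mdet M \<noteq> 0" "f 0 = vtx M" "f 1 = vtx (mmul M (mdiag 1 unif))"
    using adj[of 0] unfolding tree_adj_iff by auto
  have "f j = act_vertex M (std (int j))" if "j \<le> Suc 0" for j
    using that M vtx_std[of M 0] vtx_std[of M 1] by (cases j) auto
  with M show ?case by blast
next
  case (Suc m)
  then obtain M where M: "mdet M \<noteq> 0" "\<And>j. j \<le> Suc m \<Longrightarrow> f j = act_vertex M (std (int j))"
    by blast
  have "tree_adj p absv (act_vertex M (std (int (Suc m)))) (f (Suc (Suc m)))"
    using adj[of "Suc m"] M(2)[of "Suc m"] by simp
  moreover have "f (Suc (Suc m)) \<noteq> act_vertex M (std (int (Suc m) - 1))"
    using turn[of m] M(2)[of m] by simp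
  ultimately obtain M' where M': "mdet M' \<noteq> 0" "f (Suc (Suc m)) = act_vertex M' (std (int (Suc m) + 1))"
    "\<And>j. j \<le> int (Suc m) \<Longrightarrow> act_vertex M' (std j) = act_vertex M (std j)"
    by (rule extend_by_adjacent[OF M(1)]) blast
  have "f j = act_vertex M' (std (int j))" if "j \<le> Suc (Suc m)" for j
    using that M' M(2)[of j] by (cases "j = Suc (Suc m)") (auto simp: add.commute)
  with M' show ?case by blast
qed

lemma act_diag_std:
  assumes "a \<noteq> 0" "d \<noteq> 0" "absv d = absv a * real p powi (- k)"
  shows "act_vertex (mdiag a d) (std n) = std (n + k)"
proof -
  define u where "u = mdiag 1 (d / (a * unif powi k))"
  have "absv (d / (a * unif powi k)) = 1"
    using assms prime_gt_0_nat[OF prime] by (simp add: absv_divide absv_mult)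
  then have "u \<in> GLO" by (simp add: u_def mdiag_def GLO_iff)
  have eq: "mmul (mdiag a d) (mdiag 1 (unif powi n))
      = mmul (mdiag a a) (mmul (mdiag 1 (unif powi (n + k))) u)"
    using assms by (simp add: u_def unif_powi_add mult.commute)
  show ?thesis
    unfolding std_vertex_eq act_vtx eq vtx_mmul_scalar[OF assms(1)] vtx_mmul_GLO[OF \<open>u \<in> GLO\<close>] ..
qed

lemma geodesic_standard:
  fixes f :: "int \<Rightarrow> ('k \<times> 'k) set set"
  assumes inj: "inj f" and adj: "\<And>n. tree_adj p absv (f n) (f (n + 1))"
  obtains M where "mdet M \<noteq> 0" "\<And>j. l \<le> j \<Longrightarrow> j \<le> r \<Longrightarrow> f j = act_vertex M (std j)"
proof -
  let ?f = "\<lambda>i. f (l + int i)"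
  have "tree_adj p absv (?f i) (?f (Suc i))" for i
    using adj[of "l + int i"] by (simp add: algebra_simps)
  moreover have "?f (Suc (Suc i)) \<noteq> ?f i" for i
    using inj_eq[OF inj] by simp
  ultimately obtain M where M: "mdet M \<noteq> 0" "\<And>j. j \<le> Suc (nat (r - l)) \<Longrightarrow> ?f j = act_vertex M (std (int j))"
    using nonbacktracking_path_standard[of ?f "nat (r - l)"] by blast
  \<comment> \<open>A translation by -l, so that \<open>f j\<close> is matched with index j instead
    of j - l.\<close>
  let ?M = "mmul M (mdiag 1 (unif powi (- l)))"
  have "f j = act_vertex ?M (std j)" if "l \<le> j" "j \<le> r" for j
    using M(2)[of "nat (j - l)"] that by (simp add: act_vertex_mmul act_diag_std[of _ _ "- l"])
  then show thesis using that[of ?M] M(1) by simp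
qed

text \<open>Straightening the finite piece between the two vertices reduces this to the standard
  apartment.\<close>

lemma apartment_adj_imp:
  fixes f :: "int \<Rightarrow> ('k \<times> 'k) set set"
  assumes "inj f" "\<And>n. tree_adj p absv (f n) (f (n + 1))" "tree_adj p absv (f i) (f j)"
  shows "j = i + 1 \<or> j = i - 1"
proof -
  obtain M where M: "mdet M \<noteq> 0" "\<And>k. min i j \<le> k \<Longrightarrow> k \<le> max i j \<Longrightarrow> f k = act_vertex M (std k)"
    using geodesic_standard[OF assms(1,2)] by blast
  have "tree_adj p absv (std i) (std j)"
    using assms(3) M(2)[of i] M(2)[of j] tree_adj_act[OF M(1)] by simp
  then show ?thesis by (rule std_adj_imp)
qed

section \<open>Reflections have trace zero\<close>

lemma eq_0_of_small:
  assumes "\<And>N. \<exists>n\<ge>N. absv t ^ 2 \<le> real p powi (- n)"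
  shows "t = 0"
proof (rule ccontr)
  assume "t \<noteq> 0"
  then obtain k where k: "absv t = real p powi k" by (rule absv_value)
  \<comment> \<open>From this exponent on, p^(-n) is below p^(2k), the square of
    \<open>absv t\<close>.\<close>
  obtain n where n: "n \<ge> 1 - 2 * k" "absv t ^ 2 \<le> real p powi (- n)"
    using assms by blast
  have "real p powi (k + k) \<le> real p powi (- n)"
    using n(2) unfolding k power2_eq_square p_powi_add .
  then have "k + k \<le> - n" by (simp only: p_powi_le_iff)
  with n(1) show False by simp
qed

lemma reflects_std_trace:
  assumes "mdet g = 1" "reflects_std p absv g"
  shows "mtrace g = 0"
proof (rule eq_0_of_small)
  fix N
  obtain c where c: "\<And>n. act_vertex g (std n) = std (c - n)"
    using assms(2) unfolding reflects_std_def by blast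
  \<comment> \<open>So far out that the mirror image c - n lies on the other side, at a distance c -
    2n of at least N.\<close>
  let ?n = "- \<bar>N\<bar> - \<bar>c\<bar>"
  have "absv (mtrace g) ^ 2 \<le> real p powi (?n - (c - ?n))"
    by (rule swap_trace_bound[OF assms(1), of mone]) (simp_all add: c)
  then show "\<exists>n\<ge>N. absv (mtrace g) ^ 2 \<le> real p powi (- n)"
    by (intro exI[of _ "c - 2 * ?n"]) (simp add: algebra_simps)
qed

text \<open>The images of the two neighbours of \<open>f n\<close> are distinct neighbours of
  \<open>f m\<close> within the line, so one of them determines the other. This propagates a
  reversal of direction along the line.\<close>

lemma apartment_step:
  fixes f :: "int \<Rightarrow> ('k \<times> 'k) set set"
  assumes f: "inj f" "\<And>n. tree_adj p absv (f n) (f (n + 1))"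
    and g: "mdet g \<noteq> 0" "act_vset g (range f) = range f"
    and n: "act_vertex g (f n) = f m"
  shows "act_vertex g (f (n - 1)) = f (m + 1) \<longleftrightarrow> act_vertex g (f (n + 1)) = f (m - 1)"
proof -
  have range: "\<exists>j. act_vertex g (f k) = f j" for k
    using g(2) unfolding act_vset_def by blast
  obtain i j where i: "act_vertex g (f (n - 1)) = f i" and j: "act_vertex g (f (n + 1)) = f j"
    using range[of "n - 1"] range[of "n + 1"] by blast
  have "tree_adj p absv (f m) (f j)"
    using f(2)[of n] tree_adj_act[OF g(1), of "f n" "f (n + 1)"] n j by simp
  then have jm: "j = m + 1 \<or> j = m - 1" by (rule apartment_adj_imp[OF f])
  have "tree_adj p absv (f i) (f m)"
    using f(2)[of "n - 1"] tree_adj_act[OF g(1), of "f (n - 1)" "f n"] n i by simp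
  then have im: "m = i + 1 \<or> m = i - 1" by (rule apartment_adj_imp[OF f])
  have "i \<noteq> j"
  proof
    assume "i = j"
    then have "f (n - 1) = f (n + 1)"
      using i j injD[OF inj_act_vertex[OF g(1)]] by metis
    then show False using injD[OF f(1), of "n - 1" "n + 1"] by simp
  qed
  then show ?thesis
    unfolding i j inj_eq[OF f(1)] using im jm by auto
qed

lemma strongly_transitive_trace:
  assumes det: "\<And>g. g \<in> H \<Longrightarrow> mdet g = 1" and st: "strongly_transitive_wrt p absv H A"
  shows "\<exists>g\<in>H. mtrace g = 0"
proof -
  have apartments: "\<forall>S\<in>A. is_apartment p absv S"
    and common: "\<forall>C\<in>tree_chambers p absv. \<forall>C'\<in>tree_chambers p absv. \<exists>S\<in>A. C \<subseteq> S \<and> C' \<subseteq> S"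
    and trans: "\<forall>S\<in>A. \<forall>C. edge_of p absv S C \<longrightarrow> (\<forall>S'\<in>A. \<forall>C'. edge_of p absv S' C' \<longrightarrow>
        (\<exists>g\<in>H. act_vset g S = S' \<and> act_vset g C = C'))"
    using st unfolding strongly_transitive_wrt_def is_apartment_system_def by simp_all
  have "{std 0, std 1} \<in> tree_chambers p absv"
    using std_adj_Suc[of 0] unfolding tree_chambers_def by auto
  then obtain S where S: "S \<in> A" "is_apartment p absv S"
    using apartments bspec[OF common] by blast
  then obtain f :: "int \<Rightarrow> ('k \<times> 'k) set set" where
    f: "inj f" "\<And>n. tree_adj p absv (f n) (f (n + 1))" and S_eq: "S = range f"
    unfolding is_apartment_def by auto
  have edge: "edge_of p absv S {f n, f (n + 1)}" for n
    using f(2)[of n] unfolding edge_of_def tree_chambers_def S_eq by auto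
  have "edge_of p absv S {f (-1), f 0}" "edge_of p absv S {f 0, f 1}"
    using edge[of "-1"] edge[of 0] by simp_all
  then have "\<exists>g\<in>H. act_vset g S = S \<and> act_vset g {f (-1), f 0} = {f 0, f 1}"
    using bspec[OF trans S(1)] S(1) by simp
  then obtain g where g: "g \<in> H" "act_vset g S = S" "act_vset g {f (-1), f 0} = {f 0, f 1}"
    by blast
  have g1: "mdet g = 1" using det g(1) by blast
  then have g0: "mdet g \<noteq> 0" by simp
  \<comment> \<open>The vertices \<open>f 0\<close> and \<open>f 1\<close> have opposite types;
    hence \<open>g\<close> fixes the vertex common to both edges and turns the line over.\<close>
  have "act_vertex g (f 0) \<noteq> f 1"
  proof
    assume "act_vertex g (f 0) = f 1"
    moreover obtain M where M: "mdet M \<noteq> 0" "\<And>j. 0 \<le> j \<Longrightarrow> j \<le> 1 \<Longrightarrow> f j = act_vertex M (std j)"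
      using geodesic_standard[OF f] by blast
    ultimately have "act_vertex g (act_vertex M (std 0)) = act_vertex M (std 1)"
      using M(2)[of 0] M(2)[of 1] by simp
    then have "even (1 - 0 :: int)" by (rule std_type[OF g1 M(1)])
    then show False by simp
  qed
  moreover have "{act_vertex g (f (-1)), act_vertex g (f 0)} = {f 0, f 1}"
    using g(3) by (simp add: act_vset_def)
  ultimately have base: "act_vertex g (f 0) = f 0" "act_vertex g (f (-1)) = f 1"
    by (auto simp: doubleton_eq_iff)
  have gS: "act_vset g (range f) = range f" using g(2) S_eq by simp
  \<comment> \<open>Two neighbouring vertices are carried along, because one image alone does not
    fix the direction.\<close>
  have reflect: "act_vertex g (f n) = f (- n) \<and> act_vertex g (f (n - 1)) = f (1 - n)" for n
  proof (induction n rule: int_induct[where k = 0])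
    case base
    then show ?case using \<open>act_vertex g (f 0) = f 0\<close> \<open>act_vertex g (f (-1)) = f 1\<close> by simp
  next
    case (step1 n)
    have "- n - 1 = - (n + 1)" by simp
    with step1 show ?case using apartment_step[OF f g0 gS, of n "- n"] by simp
  next
    case (step2 n)
    have "1 - n - 1 = - n" "1 - n + 1 = 1 - (n - 1)" "- (n - 1) = 1 - n" by simp_all
    with step2 show ?case using apartment_step[OF f g0 gS, of "n - 1" "1 - n"] by simp
  qed
  have "mtrace g = 0"
  proof (rule eq_0_of_small)
    fix N
    obtain M where M: "mdet M \<noteq> 0" "\<And>j. - \<bar>N\<bar> \<le> j \<Longrightarrow> j \<le> \<bar>N\<bar> \<Longrightarrow> f j = act_vertex M (std j)"
      using geodesic_standard[OF f] by blast
    have "absv (mtrace g) ^ 2 \<le> real p powi (- \<bar>N\<bar> - \<bar>N\<bar>)"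
      by (rule swap_trace_bound[OF g1 M(1)]) (use reflect[of "\<bar>N\<bar>"] reflect[of "- \<bar>N\<bar>"] M(2)[of "\<bar>N\<bar>"] M(2)[of "- \<bar>N\<bar>"] in simp_all)
    then show "\<exists>n\<ge>N. absv (mtrace g) ^ 2 \<le> real p powi (- n)"
      by (intro exI[of _ "\<bar>N\<bar> + \<bar>N\<bar>"]) (simp add: algebra_simps)
  qed
  with g(1) show ?thesis by blast
qed

lemma absv_le_0_iff [simp]: "absv x \<le> 0 \<longleftrightarrow> x = 0"
  using absv_pos[of x] by linarith

lemma absv_not_neg [simp]: "\<not> absv x < 0"
  using absv_nonneg[of x] by linarith

lemma act_vertex_scalar:
  assumes "c \<noteq> 0" "v \<in> tree_vertices absv"
  shows "act_vertex (mdiag c c) v = v"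
  using assms by (auto simp: tree_vertices_iff vtx_mmul_scalar)

lemma std_in_tree: "std n \<in> tree_vertices absv"
  unfolding tree_vertices_iff std_vertex_eq by (intro exI[of _ "mdiag 1 (unif powi n)"]) simp

lemma act_in_tree: "mdet g \<noteq> 0 \<Longrightarrow> v \<in> tree_vertices absv \<Longrightarrow> act_vertex g v \<in> tree_vertices absv"
  unfolding tree_vertices_iff by (elim exE conjE, rule_tac x = "mmul g M" in exI) simp

section \<open>Bruhat decomposition\<close>

text \<open>Moving the matrix past diag(1, p^n) multiplies \<open>x\<close> by p^n, so vertices far
  enough in the positive direction are fixed; lower unipotents fix those far in the negative
  direction.\<close>

lemma act_upper_unipotent_std:
  assumes "absv x * real p powi (- n) \<le> 1"
  shows "act_vertex (1, x, 0, 1) (std n) = std n"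
proof -
  have "mmul (1, x, 0, 1) (mdiag 1 (unif powi n)) = mmul (mdiag 1 (unif powi n)) (1, x * unif powi n, 0, 1)"
    by (simp add: mdiag_def)
  moreover have "(1, x * unif powi n, 0, 1) \<in> GLO"
    using assms by (simp add: GLO_iff absv_mult)
  ultimately show ?thesis
    unfolding std_vertex_eq act_vtx by (simp only: vtx_mmul_GLO)
qed

lemma act_lower_unipotent_std:
  assumes "absv x * real p powi n \<le> 1"
  shows "act_vertex (1, 0, x, 1) (std n) = std n"
proof -
  have "mmul (1, 0, x, 1) (mdiag 1 (unif powi n)) = mmul (mdiag 1 (unif powi n)) (1, 0, x * unif powi (- n), 1)"
    by (simp add: mdiag_def power_int_minus)
  moreover have "(1, 0, x * unif powi (- n), 1) \<in> GLO"
    using assms by (simp only: GLO_iff absv_mult absv_unif_powi) simp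
  ultimately show ?thesis
    unfolding std_vertex_eq act_vtx by (simp only: vtx_mmul_GLO)
qed

text \<open>The pointwise stabilizer of an edge: scalars times the Iwahori subgroup, whose lower
  left entries lie in the maximal ideal.\<close>

definition fixes_base_edge :: "'k mat2 \<Rightarrow> bool" where
  "fixes_base_edge M \<longleftrightarrow> mdet M \<noteq> 0 \<and> act_vertex M (std 0) = std 0 \<and> act_vertex M (std 1) = std 1"

lemma upper_unipotent_fixes: "absv x \<le> 1 \<Longrightarrow> fixes_base_edge (1, x, 0, 1)"
proof -
  assume x: "absv x \<le> 1"
  have "absv x * real p powi (- 1) \<le> 1"
    using x p_powi_le_1_iff[of "-1"] by (intro mult_le_one) auto
  with x show ?thesis
    unfolding fixes_base_edge_def by (simp add: act_upper_unipotent_std)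
qed

lemma lower_unipotent_fixes: "absv x < 1 \<Longrightarrow> fixes_base_edge (1, 0, x, 1)"
proof -
  assume x: "absv x < 1"
  have "absv x * real p powi 1 \<le> real p powi (-1) * real p powi 1"
    using x unfolding absv_less_1_iff by (intro mult_right_mono) auto
  also have "\<dots> = 1" unfolding p_powi_add[symmetric] by simp
  finally show ?thesis
    using x unfolding fixes_base_edge_def by (simp add: act_lower_unipotent_std)
qed

text \<open>Gaussian elimination with restricted operations: upper unipotents may have any entry in
  O, lower ones only entries in the maximal ideal.\<close>

lemma bruhat_decomposition:
  assumes "mdet K \<noteq> 0"
  shows "\<exists>P Q. fixes_base_edge P \<and> fixes_base_edge Q \<and>
     ((\<exists>a d. mmul P (mmul K Q) = (a, 0, 0, d)) \<or> (\<exists>b c. mmul P (mmul K Q) = (0, b, c, 0)))"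
proof -
  obtain a b c d where K: "K = (a,b,c,d)" by (cases K rule: prod_cases4)
  have ratio_le: "absv (- (x / y)) \<le> 1" if "absv x \<le> absv y" for x y
    using that by (cases "y = 0") (simp_all add: absv_divide)
  have ratio_less: "absv (- (x / y)) < 1" if "absv x < absv y" for x y
    using that by (cases "y = 0") (simp_all add: absv_divide)
  \<comment> \<open>The pivots are c, a, d, b, in this order. A strict inequality stands where a
    lower unipotent is used.\<close>
  consider "absv a \<le> absv c" "absv d \<le> absv c" | "absv c < absv a" "absv b \<le> absv a"
    | "absv c < absv d" "absv b \<le> absv d" | "absv d < absv b" "absv a < absv b"
    by linarith
  then show ?thesis
  proof cases
    case 1
    have "c \<noteq> 0" using assms 1 by (auto simp: K)
    then have "mmul (1, - (a / c), 0, 1) (mmul K (1, - (d / c), 0, 1)) = (0, b - a * d / c, c, 0)"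
      by (simp add: K field_simps)
    then show ?thesis using upper_unipotent_fixes ratio_le 1 by blast
  next
    case 2
    have "a \<noteq> 0" using 2(1) by auto
    then have "mmul (1, 0, - (c / a), 1) (mmul K (1, - (b / a), 0, 1)) = (a, 0, 0, d - b * c / a)"
      by (simp add: K field_simps)
    then show ?thesis using upper_unipotent_fixes ratio_le lower_unipotent_fixes ratio_less 2 by blast
  next
    case 3
    have "d \<noteq> 0" using 3(1) by auto
    then have "mmul (1, - (b / d), 0, 1) (mmul K (1, 0, - (c / d), 1)) = (a - b * c / d, 0, 0, d)"
      by (simp add: K field_simps)
    then show ?thesis using upper_unipotent_fixes ratio_le lower_unipotent_fixes ratio_less 3 by blast
  next
    case 4
    have "b \<noteq> 0" using 4(1) by auto
    then have "mmul (1, 0, - (d / b), 1) (mmul K (1, 0, - (a / b), 1)) = (0, b, c - a * d / b, 0)"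
      by (simp add: K field_simps)
    then show ?thesis using lower_unipotent_fixes ratio_less 4 by blast
  qed
qed

lemma act_diag_std_ex:
  assumes "a \<noteq> 0" "d \<noteq> 0"
  obtains k where "\<And>n. act_vertex (mdiag a d) (std n) = std (n + k)"
proof -
  obtain l where l: "absv (d / a) = real p powi l"
    by (rule absv_value[of "d / a"]) (use assms in auto)
  have "absv d = absv a * real p powi (- (- l))"
    using l assms by (simp add: absv_divide field_simps)
  then show thesis using that[of "- l"] act_diag_std[OF assms] by blast
qed

lemma act_swap_std: "act_vertex (0, 1, 1, 0) (std n) = std (- n)"
proof -
  have "mmul (0, 1, 1, 0) (mdiag 1 (unif powi n))
      = mmul (mdiag (unif powi n) (unif powi n)) (mmul (mdiag 1 (unif powi (- n))) (0, 1, 1, 0))"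
    by (simp add: mdiag_def power_int_minus)
  moreover have "(0, 1, 1, 0) \<in> GLO" by (simp add: GLO_iff)
  ultimately show ?thesis
    unfolding std_vertex_eq act_vtx by (simp add: vtx_mmul_scalar vtx_mmul_GLO del: mmul_simp)
qed

lemma act_antidiag_std:
  assumes "b \<noteq> 0" "c \<noteq> 0" "absv b = absv c * real p powi (- k)"
  shows "act_vertex (0, b, c, 0) (std n) = std (- n - k)"
proof -
  have "(0, b, c, 0) = mmul (0, 1, 1, 0) (mdiag c b)" by (simp add: mdiag_def)
  then show ?thesis
    using act_diag_std[OF assms(2,1,3)] by (simp add: act_vertex_mmul act_swap_std del: mmul_simp)
qed

lemma act_monomial_std:
  assumes "mdet M \<noteq> 0" "(\<exists>a d. M = (a, 0, 0, d)) \<or> (\<exists>b c. M = (0, b, c, 0))"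
  shows "\<exists>m. act_vertex M (std n) = std m"
  using assms(2)
proof
  assume "\<exists>a d. M = (a, 0, 0, d)"
  then obtain a d where M: "M = mdiag a d" by (auto simp: mdiag_def)
  then have "a \<noteq> 0" "d \<noteq> 0" using assms(1) by auto
  then show ?thesis unfolding M using act_diag_std_ex by metis
next
  assume "\<exists>b c. M = (0, b, c, 0)"
  then obtain b c where M: "M = mmul (0, 1, 1, 0) (mdiag c b)" by (auto simp: mdiag_def)
  then have "b \<noteq> 0" "c \<noteq> 0" using assms(1) by auto
  then obtain k where "act_vertex (mdiag c b) (std n) = std (n + k)"
    using act_diag_std_ex[of c b] by metis
  then show ?thesis unfolding M act_vertex_mmul by (auto simp: act_swap_std)
qed

lemma tree_chamber_standard:
  assumes "C \<in> tree_chambers p absv"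
  obtains M where "mdet M \<noteq> 0" "C = act_vset M {std 0, std 1}"
proof -
  obtain v w where C: "C = {v, w}" and "tree_adj p absv v w"
    using assms unfolding tree_chambers_def by blast
  then obtain M where M: "mdet M \<noteq> 0" "v = vtx M" "w = vtx (mmul M (mdiag 1 unif))"
    unfolding tree_adj_iff by blast
  then have "C = act_vset M {std 0, std 1}"
    using C vtx_std[of M 0] vtx_std[of M 1] by (simp add: act_vset_def)
  with M(1) show thesis by (rule that)
qed

text \<open>Write h^-1 k = P^-1 N Q^-1 with N monomial. Then h P^-1 maps the standard apartment to
  one containing C, since P fixes the base edge, and C', since h P^-1 N = k Q. A finite
  \<open>F\<close> is recorded because approximation by G works on finite sets of vertices.\<close>

lemma chambers_in_common_apartment:
  assumes "C \<in> tree_chambers p absv" "C' \<in> tree_chambers p absv"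
  obtains M F where "mdet M = 1" "finite F" "C \<subseteq> act_vset M (std ` F)" "C' \<subseteq> act_vset M (std ` F)"
proof -
  obtain h where h: "mdet h \<noteq> 0" "C = act_vset h {std 0, std 1}"
    using tree_chamber_standard[OF assms(1)] .
  obtain k where k: "mdet k \<noteq> 0" "C' = act_vset k {std 0, std 1}"
    using tree_chamber_standard[OF assms(2)] .
  obtain P Q where P: "fixes_base_edge P" and Q: "fixes_base_edge Q"
    and mono: "(\<exists>a d. mmul P (mmul (mmul (minv h) k) Q) = (a, 0, 0, d)) \<or>
      (\<exists>b c. mmul P (mmul (mmul (minv h) k) Q) = (0, b, c, 0))"
    using bruhat_decomposition[of "mmul (minv h) k"] h k by auto
  define N where "N = mmul P (mmul (mmul (minv h) k) Q)"
  have det: "mdet P \<noteq> 0" "mdet Q \<noteq> 0" using P Q by (simp_all add: fixes_base_edge_def)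
  then have "mdet N \<noteq> 0" using h k by (simp add: N_def)
  then obtain i j where ij: "act_vertex N (std 0) = std i" "act_vertex N (std 1) = std j"
    using act_monomial_std mono unfolding N_def by metis
  define M where "M = mmul h (minv P)"
  have M0: "mdet M \<noteq> 0" using h det by (simp add: M_def)
  have P_inv: "act_vertex (minv P) (std 0) = std 0" "act_vertex (minv P) (std 1) = std 1"
    using act_vertex_inverse(1)[OF det(1)] P unfolding fixes_base_edge_def by metis+
  have MN: "act_vertex M (act_vertex N v) = act_vertex k (act_vertex Q v)" for v
    using h det by (simp add: M_def N_def mmul_assoc flip: act_vertex_mmul)
  have "C = {act_vertex M (std 0), act_vertex M (std 1)}"
    using h P_inv by (simp add: M_def act_vset_def act_vertex_mmul)
  moreover have "C' = {act_vertex M (std i), act_vertex M (std j)}"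
    using k Q MN[of "std 0"] MN[of "std 1"] ij by (simp add: act_vset_def fixes_base_edge_def)
  moreover
  obtain l where l: "\<And>n. act_vertex (mdiag 1 (inverse (mdet M))) (std n) = std (n + l)"
    using act_diag_std_ex[of 1 "inverse (mdet M)"] M0 by auto
  \<comment> \<open>The correction to determinant 1 merely translates the standard apartment;
    indices shift by \<open>l\<close>.\<close>
  define M' where "M' = mmul M (mdiag 1 (inverse (mdet M)))"
  have "act_vertex M (std n) = act_vertex M' (std (n - l))" for n
    by (simp add: M'_def act_vertex_mmul l)
  ultimately have "C \<subseteq> act_vset M' (std ` {- l, 1 - l, i - l, j - l})"
    "C' \<subseteq> act_vset M' (std ` {- l, 1 - l, i - l, j - l})"
    by (auto simp: act_vset_def)
  moreover have "mdet M' = 1" using M0 by (simp add: M'_def)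
  ultimately show thesis using that[of M' "{- l, 1 - l, i - l, j - l}"] by blast
qed

section \<open>Local constancy of the action\<close>

definition entries_less :: "real \<Rightarrow> 'k mat2 \<Rightarrow> bool" where
  "entries_less e M \<longleftrightarrow> (case M of (a,b,c,d) \<Rightarrow> absv a < e \<and> absv b < e \<and> absv c < e \<and> absv d < e)"

lemma entries_less_simp [simp]:
  "entries_less e (a,b,c,d) \<longleftrightarrow> absv a < e \<and> absv b < e \<and> absv c < e \<and> absv d < e"
  by (simp add: entries_less_def)

lemma entries_less_mono: "entries_less e M \<Longrightarrow> e \<le> e' \<Longrightarrow> entries_less e' M"
  by (cases M rule: prod_cases4) auto

lemma entries_less_ex: "\<exists>e>0. entries_less e M"
proof -
  obtain a b c d where M: "M = (a,b,c,d)" by (cases M rule: prod_cases4)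
  show ?thesis
    using absv_nonneg[of a] absv_nonneg[of b] absv_nonneg[of c] absv_nonneg[of d]
    unfolding M entries_less_simp
    by (intro exI[of _ "absv a + absv b + absv c + absv d + 1"] conjI) linarith+
qed

lemma entries_less_mmul:
  assumes "entries_less e M" "entries_less e' N"
  shows "entries_less (e * e') (mmul M N)"
proof -
  have "absv (x * y) < e * e'" if "absv x < e" "absv y < e'" for x y
    using that by (simp add: absv_mult mult_strict_mono')
  with assms show ?thesis
    by (cases M rule: prod_cases4; cases N rule: prod_cases4) (auto intro!: absv_add_less)
qed

lemma GLO_near_one:
  assumes "entries_less 1 (msub U mone)"
  shows "U \<in> GLO"
proof -
  obtain a b c d where U: "U = (a,b,c,d)" by (cases U rule: prod_cases4)
  have lt: "absv (a - 1) < 1" "absv b < 1" "absv c < 1" "absv (d - 1) < 1"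
    using assms by (simp_all add: U mdiag_def)
  have eq1: "absv x = 1" if "absv (x - 1) < 1" for x
    using that absv_eq_of_close[of 1 x] absv_minus[of "x - 1"] by simp
  have mult: "absv (x * y) < 1" if "absv x < 1" "absv y < 1" for x y
    using that mult_strict_mono'[of "absv x" 1 "absv y" 1] by (simp add: absv_mult)
  have "a * d - b * c - 1 = (a - 1) + (d - 1) + (a - 1) * (d - 1) - b * c"
    by (simp add: algebra_simps)
  also have "absv \<dots> < 1"
    by (intro absv_diff_less absv_add_less mult lt)
  finally have "absv (a * d - b * c) = 1" by (rule eq1)
  then show ?thesis
    using lt eq1[of a] eq1[of d] by (simp add: U GLO_iff)
qed

text \<open>Vertex stabilizers are open: g' h = (g h) U, where U - 1 = (g h)^-1 (g' - g) h is so
  small that U lies in \<open>GLO\<close>.\<close>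

lemma act_vertex_locally_constant:
  assumes "mdet g \<noteq> 0" "v \<in> tree_vertices absv"
  shows "\<exists>e>0. \<forall>g'. entries_less e (msub g' g) \<longrightarrow> act_vertex g' v = act_vertex g v"
proof -
  obtain h where h: "mdet h \<noteq> 0" "v = vtx h" using assms(2) tree_vertices_iff by blast
  define n where "n = minv (mmul g h)"
  have gh: "mdet (mmul g h) \<noteq> 0" using assms(1) h(1) by simp
  obtain e1 e2 where e: "e1 > 0" "entries_less e1 n" "e2 > 0" "entries_less e2 h"
    using entries_less_ex by meson
  \<comment> \<open>This radius cancels the sizes of (g h)^-1 and h and leaves the bound 1 of
    \<open>GLO_near_one\<close>.\<close>
  have "act_vertex g' v = act_vertex g v" if g': "entries_less (inverse (e1 * e2)) (msub g' g)" for g'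
  proof -
    define U where "U = mmul n (mmul g' h)"
    have "entries_less (e1 * (inverse (e1 * e2) * e2)) (mmul n (mmul (msub g' g) h))"
      using e g' by (intro entries_less_mmul)
    moreover have "mmul n (mmul (msub g' g) h) = msub U mone"
      unfolding mmul_msub_left mmul_msub_right U_def n_def minv_left[OF gh] ..
    moreover have "e1 * (inverse (e1 * e2) * e2) = 1" using e by (simp add: field_simps)
    ultimately have "U \<in> GLO" using GLO_near_one by simp
    moreover have "mmul g' h = mmul (mmul g h) U"
      unfolding U_def n_def minv_cancel(1)[OF gh] ..
    ultimately show ?thesis unfolding h(2) act_vtx by (simp only: vtx_mmul_GLO)
  qed
  then show ?thesis using e by (intro exI[of _ "inverse (e1 * e2)"]) auto
qed

lemma act_finite_locally_constant:
  assumes "mdet g \<noteq> 0" "finite F" "F \<subseteq> tree_vertices absv"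
  shows "\<exists>e>0. \<forall>g'. entries_less e (msub g' g) \<longrightarrow> (\<forall>v\<in>F. act_vertex g' v = act_vertex g v)"
  using assms(2,3)
proof (induction F rule: finite_induct)
  case empty
  then show ?case by (intro exI[of _ 1]) simp
next
  case (insert v F)
  then obtain e where e: "e > 0" "\<And>g' v. entries_less e (msub g' g) \<Longrightarrow> v \<in> F \<Longrightarrow> act_vertex g' v = act_vertex g v"
    by auto
  obtain e' where e': "e' > 0" "\<And>g'. entries_less e' (msub g' g) \<Longrightarrow> act_vertex g' v = act_vertex g v"
    using act_vertex_locally_constant[OF assms(1), of v] insert.prems by auto
  have "act_vertex g' w = act_vertex g w"
    if "entries_less (min e e') (msub g' g)" "w \<in> insert v F" for g' w
    using that(2) e(2)[of g' w] e'(2)[of g'] entries_less_mono[OF that(1), of e] entries_less_mono[OF that(1), of e']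
    by auto
  with e(1) e'(1) show ?case by (intro exI[of _ "min e e'"]) auto
qed

lemma det_nonzero_near:
  assumes "mdet g \<noteq> 0"
  shows "\<exists>e>0. \<forall>g'. entries_less e (msub g' g) \<longrightarrow> mdet g' \<noteq> 0"
proof -
  obtain e where e: "e > 0" "entries_less e (minv g)" using entries_less_ex by meson
  have "mdet g' \<noteq> 0" if g': "entries_less (inverse e) (msub g' g)" for g'
  proof -
    have "entries_less (e * inverse e) (mmul (minv g) (msub g' g))"
      using e g' by (intro entries_less_mmul)
    then have "mmul (minv g) g' \<in> GLO"
      using e assms by (intro GLO_near_one) (simp add: mmul_msub_left)
    then show ?thesis using GLO_det by fastforce
  qed
  with e show ?thesis by (intro exI[of _ "inverse e"]) auto
qed

end

section \<open>Norm-one quaternions\<close>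

locale split_quaternion = Qp_field p absv for p and absv :: "'k::field_char_0 \<Rightarrow> real" +
  fixes \<alpha> \<beta> :: rat and s :: 'k
  assumes sqrt: "s * s = of_rat \<alpha>"
begin

lemma qmat_qmul: "qmat s \<beta> (qmul \<alpha> \<beta> x y) = mmul (qmat s \<beta> x) (qmat s \<beta> y)"
  by (cases x rule: prod_cases4; cases y rule: prod_cases4)
     (simp add: qmat_def qmul_def of_rat_add of_rat_mult of_rat_diff algebra_simps flip: sqrt)

lemma mdet_qmat: "mdet (qmat s \<beta> x) = of_rat (qnorm \<alpha> \<beta> x)"
  by (cases x rule: prod_cases4)
     (simp add: qmat_def qnorm_def of_rat_add of_rat_mult of_rat_diff algebra_simps power2_eq_square flip: sqrt)

lemma mdet_normone: "g \<in> qmat s \<beta> ` normone \<alpha> \<beta> \<Longrightarrow> mdet g = 1"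
  by (auto simp: mdet_qmat normone_def)

text \<open>The trace is 2 x1, and a pure quaternion squares to minus its norm.\<close>

lemma trace_0_imp_sqrt_minus1:
  assumes "x \<in> normone \<alpha> \<beta>" "mtrace (qmat s \<beta> x) = 0"
  shows "has_sqrt_minus1 \<alpha> \<beta>"
proof -
  obtain x1 x2 x3 x4 where x: "x = (x1, x2, x3, x4)" by (cases x rule: prod_cases4)
  have "x1 = 0" using assms(2) by (simp add: x qmat_def)
  with assms(1) have "qmul \<alpha> \<beta> x x = (-1, 0, 0, 0)"
    by (simp add: x qmul_def normone_def qnorm_def power2_eq_square algebra_simps)
  then show ?thesis unfolding has_sqrt_minus1_def by blast
qed

abbreviation G :: "'k mat2 set" where
  "G \<equiv> qmat s \<beta> ` normone \<alpha> \<beta>"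

text \<open>Multiplicativity of the determinant, pulled back along the embedding of the rationals
  into K.\<close>

lemma qnorm_qmul: "qnorm \<alpha> \<beta> (qmul \<alpha> \<beta> x y) = qnorm \<alpha> \<beta> x * qnorm \<alpha> \<beta> y"
proof -
  have "(of_rat (qnorm \<alpha> \<beta> (qmul \<alpha> \<beta> x y)) :: 'k) = of_rat (qnorm \<alpha> \<beta> x * qnorm \<alpha> \<beta> y)"
    by (simp add: qmat_qmul of_rat_mult flip: mdet_qmat)
  then show ?thesis by (simp only: of_rat_eq_iff)
qed

lemma G_mmul: "g \<in> G \<Longrightarrow> h \<in> G \<Longrightarrow> mmul g h \<in> G"
  by (auto simp: normone_def qnorm_qmul simp flip: qmat_qmul)

lemma G_minv: "g \<in> G \<Longrightarrow> minv g \<in> G"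
proof -
  assume "g \<in> G"
  then obtain x where x: "x \<in> normone \<alpha> \<beta>" "g = qmat s \<beta> x" by blast
  obtain x1 x2 x3 x4 where x_eq: "x = (x1, x2, x3, x4)" by (cases x rule: prod_cases4)
  have "mdet (qmat s \<beta> x) = 1" using x(1) by (intro mdet_normone) blast
  \<comment> \<open>The conjugate quaternion inverts an element of norm 1.\<close>
  then have "minv g = qmat s \<beta> (x1, - x2, - x3, - x4)"
    unfolding x(2) x_eq by (simp add: minv_def qmat_def of_rat_minus algebra_simps)
  moreover have "(x1, - x2, - x3, - x4) \<in> normone \<alpha> \<beta>"
    using x(1) by (simp add: x_eq normone_def qnorm_def)
  ultimately show ?thesis by blast
qed

text \<open>The quaternion w^2 / N(w) has norm N(w)^2 / N(w)^2 = 1, and the rational scalar 1 / N(w)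
  acts trivially on vertices.\<close>

lemma square_over_norm_in_G:
  assumes "mdet (qmat s \<beta> w) \<noteq> 0"
  shows "\<exists>g\<in>G. \<forall>v\<in>tree_vertices absv.
    act_vertex g v = act_vertex (qmat s \<beta> w) (act_vertex (qmat s \<beta> w) v)"
proof -
  define r where "r = 1 / qnorm \<alpha> \<beta> w"
  have N: "qnorm \<alpha> \<beta> w \<noteq> 0" using assms by (simp add: mdet_qmat)
  define x where "x = qmul \<alpha> \<beta> (r, 0, 0, 0) (qmul \<alpha> \<beta> w w)"
  have "qnorm \<alpha> \<beta> x = r ^ 2 * qnorm \<alpha> \<beta> w ^ 2"
    by (simp add: x_def qnorm_qmul power2_eq_square) (simp add: qnorm_def power2_eq_square)
  then have "x \<in> normone \<alpha> \<beta>" using N by (simp add: normone_def r_def power2_eq_square)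
  moreover have "act_vertex (qmat s \<beta> x) v = act_vertex (qmat s \<beta> w) (act_vertex (qmat s \<beta> w) v)"
    if v: "v \<in> tree_vertices absv" for v
  proof -
    have "qmat s \<beta> (r, 0, 0, 0) = mdiag (of_rat r) (of_rat r)"
      by (simp add: qmat_def mdiag_def)
    then show ?thesis
      using N assms v by (simp add: x_def qmat_qmul act_vertex_mmul act_vertex_scalar act_in_tree r_def)
  qed
  ultimately show ?thesis by blast
qed

section \<open>Density of the quaternions and of G\<close>

text \<open>The system x1 + x2 s = u, x1 - x2 s = v has the solution (u + v)/2, (u - v)/(2s) in K,
  which is approximated by rationals.\<close>

lemma quadratic_field_dense:
  assumes "s \<noteq> 0" "e > 0"
  obtains x1 x2 where "absv (of_rat x1 + of_rat x2 * s - u) < e" "absv (of_rat x1 - of_rat x2 * s - v) < e"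
proof -
  obtain x1 where "absv ((u + v) / 2 - of_rat x1) < e"
    using rat_dense[OF assms(2)] by blast
  then have 1: "absv (of_rat x1 - (u + v) / 2) < e"
    using absv_minus[of "of_rat x1 - (u + v) / 2"] by (simp del: absv_minus)
  have "e / absv s > 0" using assms by simp
  then obtain x2 where "absv ((u - v) / (2 * s) - of_rat x2) < e / absv s"
    using rat_dense by blast
  then have "absv (((u - v) / (2 * s) - of_rat x2) * s) < e"
    using assms(1) by (simp add: absv_mult pos_less_divide_eq)
  moreover have "((u - v) / (2 * s) - of_rat x2) * s = (u - v) / 2 - of_rat x2 * s"
    using assms(1) by (simp add: field_simps)
  ultimately have 2: "absv ((u - v) / 2 - of_rat x2 * s) < e" by simp
  have "of_rat x1 + of_rat x2 * s - u = (of_rat x1 - (u + v) / 2) - ((u - v) / 2 - of_rat x2 * s)"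
    "of_rat x1 - of_rat x2 * s - v = (of_rat x1 - (u + v) / 2) + ((u - v) / 2 - of_rat x2 * s)"
    by (simp_all add: field_simps)
  then show thesis
    using that absv_diff_less[OF 1 2] absv_add_less[OF 1 2] by metis
qed

text \<open>The diagonal involves only x1, x2 and the other two entries only x3, x4, so the
  preceding approximation applies twice.\<close>

lemma quaternions_dense:
  assumes "s \<noteq> 0" "\<beta> \<noteq> 0" "e > 0"
  obtains w where "entries_less e (msub (qmat s \<beta> w) M)"
proof -
  obtain a b c d where M: "M = (a,b,c,d)" by (cases M rule: prod_cases4)
  define b' :: 'k where "b' = of_rat \<beta>"
  have b': "b' \<noteq> 0" using assms(2) by (simp add: b'_def)
  obtain x1 x2 where 12: "absv (of_rat x1 + of_rat x2 * s - a) < e" "absv (of_rat x1 - of_rat x2 * s - d) < e"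
    using quadratic_field_dense[OF assms(1,3)] .
  \<comment> \<open>Only the upper right entry carries the factor \<beta>; one precision has to
    serve both entries.\<close>
  have "min e (e / absv b') > 0" using assms b' by simp
  then obtain x3 x4 where 34: "absv (of_rat x3 + of_rat x4 * s - b / b') < min e (e / absv b')"
      "absv (of_rat x3 - of_rat x4 * s - c) < min e (e / absv b')"
    using quadratic_field_dense[OF assms(1)] by metis
  have "absv (b' * (of_rat x3 + of_rat x4 * s - b / b')) < e"
    using 34(1) b' by (simp add: absv_mult pos_less_divide_eq mult.commute)
  moreover have "b' * (of_rat x3 + of_rat x4 * s - b / b') = b' * (of_rat x3 + of_rat x4 * s) - b"
    using b' by (simp add: algebra_simps)
  ultimately show thesis
    using 12 34(2) that[of "(x1, x2, x3, x4)"] by (simp add: M qmat_def b'_def)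
qed

text \<open>By Cayley--Hamilton, a matrix h of determinant 1 and trace t satisfies (1 + h)^2 = (2 + t) h,
  so a quaternion w near 1 + h yields the element w^2 / N(w) of G near h. The excluded case t = -2
  is avoided by passing to -h, which acts in the same way.\<close>

lemma weak_approximation:
  assumes "s \<noteq> 0" "\<beta> \<noteq> 0" and h: "mdet h = 1" and F: "finite F" "F \<subseteq> tree_vertices absv"
  shows "\<exists>g\<in>G. \<forall>v\<in>F. act_vertex g v = act_vertex h v"
proof -
  have "\<exists>h'. mdet h' = 1 \<and> mtrace h' \<noteq> -2 \<and> (\<forall>v\<in>F. act_vertex h' v = act_vertex h v)"
  proof (cases "mtrace h = -2")
    case True
    let ?h = "mmul (mdiag (-1) (-1)) h"
    have "mtrace ?h = - mtrace h" by (cases h rule: prod_cases4) (simp add: mdiag_def)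
    then have "mtrace ?h = 2" using True by simp
    moreover have "(2::'k) \<noteq> -2" by (simp add: eq_neg_iff_add_eq_0)
    ultimately have "mtrace ?h \<noteq> -2" by simp
    moreover have "act_vertex ?h v = act_vertex h v" if "v \<in> F" for v
      using that F h by (simp add: act_vertex_mmul act_vertex_scalar act_in_tree subset_iff)
    ultimately show ?thesis using h by (intro exI[of _ ?h]) simp
  qed (use h in blast)
  then obtain k where k: "mdet k = 1" "mtrace k \<noteq> -2" "\<And>v. v \<in> F \<Longrightarrow> act_vertex k v = act_vertex h v"
    by blast
  obtain a b c d where k_eq: "k = (a,b,c,d)" by (cases k rule: prod_cases4)
  define k1 where "k1 = (a + 1, b, c, d + 1)"
  define t where "t = 2 + mtrace k"
  have t: "t \<noteq> 0"
  proof
    assume "t = 0"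
    then have "mtrace k = -2" by (simp add: t_def eq_neg_iff_add_eq_0 add.commute)
    with k(2) show False by simp
  qed
  \<comment> \<open>det (1 + k) = 1 + tr k + det k, so excluding trace -2 makes 1 + k
    invertible.\<close>
  have det: "mdet k1 = t" using k(1) by (simp add: k1_def t_def k_eq algebra_simps)
  then have det0: "mdet k1 \<noteq> 0" using t by simp
  have ad: "a * d = 1 + b * c" using k(1) by (simp add: k_eq algebra_simps)
  have square: "mmul k1 k1 = mmul (mdiag t t) k"
    by (simp add: k1_def t_def k_eq mdiag_def algebra_simps ad)
  \<comment> \<open>The quaternion is applied twice, so it has to agree with \<open>k1\<close> on
    the image of \<open>F\<close> as well.\<close>
  let ?F = "F \<union> act_vertex k1 ` F"
  have F': "finite ?F" "?F \<subseteq> tree_vertices absv" using F act_in_tree[OF det0] by auto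
  from act_finite_locally_constant[OF det0 F'] obtain e where "e > 0"
    and "\<forall>g'. entries_less e (msub g' k1) \<longrightarrow> (\<forall>v\<in>?F. act_vertex g' v = act_vertex k1 v)"
    by (elim exE conjE)
  then have e: "e > 0" "\<And>g' v. entries_less e (msub g' k1) \<Longrightarrow> v \<in> ?F \<Longrightarrow> act_vertex g' v = act_vertex k1 v"
    by blast+
  obtain e' where e': "e' > 0" "\<And>g'. entries_less e' (msub g' k1) \<Longrightarrow> mdet g' \<noteq> 0"
    using det_nonzero_near[OF det0] by blast
  have "min e e' > 0" using e e' by simp
  then obtain w where w: "entries_less (min e e') (msub (qmat s \<beta> w) k1)"
    by (rule quaternions_dense[OF assms(1,2)])
  have we: "entries_less e (msub (qmat s \<beta> w) k1)" "entries_less e' (msub (qmat s \<beta> w) k1)"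
    by (rule entries_less_mono[OF w]; simp)+
  obtain g where g: "g \<in> G"
    "\<forall>v\<in>tree_vertices absv. act_vertex g v = act_vertex (qmat s \<beta> w) (act_vertex (qmat s \<beta> w) v)"
    using square_over_norm_in_G[OF e'(2)[OF we(2)]] by blast
  have "act_vertex g v = act_vertex h v" if v: "v \<in> F" for v
  proof -
    have v_tree: "v \<in> tree_vertices absv" using v F by blast
    have "act_vertex g v = act_vertex k1 (act_vertex k1 v)"
      using bspec[OF g(2) v_tree] e(2)[OF we(1)] v by simp
    also have "\<dots> = act_vertex (mdiag t t) (act_vertex k v)"
      by (simp only: square flip: act_vertex_mmul)
    also have "\<dots> = act_vertex k v"
      by (intro act_vertex_scalar t act_in_tree v_tree) (simp add: k(1))
    also have "\<dots> = act_vertex h v" by (rule k(3)[OF v])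
    finally show ?thesis .
  qed
  with g(1) show ?thesis by blast
qed

section \<open>Elements of G acting on the standard apartment\<close>

text \<open>Quaternions in Q + Q e2 are diagonal, with independently approximable entries. Absolute
  values 1 and p^(-k) give a shift by k, which w^2 / N(w) doubles.\<close>

lemma translation_in_G:
  assumes "s \<noteq> 0"
  shows "\<exists>g\<in>G. \<forall>n. act_vertex g (std n) = std (n + 2 * k)"
proof -
  \<comment> \<open>Within this distance of 1 and of p^k, respectively, the absolute value stays the
    same.\<close>
  have e: "min 1 (real p powi (- k)) > 0" using p_pos by (simp del: of_nat_0_less_iff)
  obtain x1 x2 where x: "absv (of_rat x1 + of_rat x2 * s - 1) < min 1 (real p powi (- k))"
    "absv (of_rat x1 - of_rat x2 * s - unif powi k) < min 1 (real p powi (- k))"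
    using quadratic_field_dense[OF assms e] .
  let ?a = "of_rat x1 + of_rat x2 * s" and ?d = "of_rat x1 - of_rat x2 * s"
  have "absv ?a = absv 1" "absv ?d = absv (unif powi k)"
    using x absv_eq_of_close[of 1 ?a] absv_eq_of_close[of "unif powi k" ?d]
      absv_minus[of "?a - 1"] absv_minus[of "?d - unif powi k"] by (simp_all del: absv_minus)
  then have a: "absv ?a = 1" and d: "absv ?d = real p powi (- k)" by simp_all
  have "absv ?a > 0" "absv ?d > 0" unfolding a d using e by simp_all
  then have 0: "?a \<noteq> 0" "?d \<noteq> 0" unfolding absv_pos .
  have shift: "act_vertex (mdiag ?a ?d) (std n) = std (n + k)" for n
    using a d by (intro act_diag_std 0) simp
  have w: "qmat s \<beta> (x1, x2, 0, 0) = mdiag ?a ?d" by (simp add: qmat_def mdiag_def)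
  have "mdet (qmat s \<beta> (x1, x2, 0, 0)) \<noteq> 0" using 0 by (simp add: w)
  from square_over_norm_in_G[OF this] obtain g where g: "g \<in> G"
    "\<forall>v\<in>tree_vertices absv. act_vertex g v = act_vertex (mdiag ?a ?d) (act_vertex (mdiag ?a ?d) v)"
    unfolding w by blast
  have "act_vertex g (std n) = std (n + 2 * k)" for n
    using bspec[OF g(2) std_in_tree[of n]] by (simp add: shift add.commute)
  with g(1) show ?thesis by blast
qed

text \<open>The element e3 has norm -\<beta> = 1 and an antidiagonal matrix whose entries are
  units.\<close>

lemma reflection_in_G:
  assumes "\<beta> = -1"
  shows "\<exists>g\<in>G. \<forall>n. act_vertex g (std n) = std (- n)"
proof (intro bexI allI)
  show "qmat s \<beta> (0, 0, 1, 0) \<in> G"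
    using assms by (intro imageI) (simp add: normone_def qnorm_def)
  have "qmat s \<beta> (0, 0, 1, 0) = (0, -1, 1, 0)"
    using assms by (simp add: qmat_def)
  then show "act_vertex (qmat s \<beta> (0, 0, 1, 0)) (std n) = std (- n)" for n
    using act_antidiag_std[of "-1" 1 0 n] by simp
qed

lemma std_apartment_stabilized:
  assumes "\<And>n. act_vertex g (std n) = std (\<phi> n)" "surj \<phi>"
  shows "act_vset g (range std) = range std"
  using assms by (simp add: act_vset_def image_image) (metis image_image)

text \<open>Even translations reach the edges with even \<open>i\<close>. For odd \<open>i\<close>,
  the map n to 2k - n with 2k = i + 1 sends 0 to i + 1 and 1 to i, which suffices as edges are
  unordered.\<close>

lemma G_transitive_on_std_edges:
  assumes "s \<noteq> 0" "\<beta> = -1"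
  shows "\<exists>g\<in>G. act_vset g (range std) = range std \<and>
    act_vset g {std 0, std 1} = {std i, std (i + 1)}"
proof (cases "even i")
  case True
  then obtain k where k: "i = 2 * k" by blast
  obtain g where g: "g \<in> G" "\<forall>n. act_vertex g (std n) = std (n + 2 * k)"
    using translation_in_G[OF assms(1), of k] by blast
  have "act_vset g (range std) = range std"
    by (rule std_apartment_stabilized[OF spec[OF g(2)]], rule surjI[of _ "\<lambda>n. n - 2 * k"]) simp
  moreover have "act_vset g {std 0, std 1} = {std i, std (i + 1)}"
    by (simp add: act_vset_def g(2) k add.commute)
  ultimately show ?thesis using g(1) by (intro bexI[of _ g]) simp_all
next
  case False
  then have "even (i + 1)" by simp
  then obtain k where k: "i + 1 = 2 * k" by blast
  obtain g where g: "g \<in> G" "\<forall>n. act_vertex g (std n) = std (n + 2 * k)"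
    using translation_in_G[OF assms(1), of k] by blast
  obtain r where r: "r \<in> G" "\<forall>n. act_vertex r (std n) = std (- n)"
    using reflection_in_G[OF assms(2)] by blast
  have gr: "act_vertex (mmul g r) (std n) = std (2 * k - n)" for n
    by (simp add: act_vertex_mmul r g)
  have "act_vset (mmul g r) (range std) = range std"
    by (rule std_apartment_stabilized[OF gr], rule surjI[of _ "\<lambda>n. 2 * k - n"]) simp
  moreover have "2 * k - 1 = i" using k by simp
  then have "act_vset (mmul g r) {std 0, std 1} = {std i, std (i + 1)}"
    by (simp add: act_vset_def gr insert_commute k)
  ultimately show ?thesis using G_mmul[OF g(1) r(1)] by (intro bexI[of _ "mmul g r"]) simp_all
qed

section \<open>The orbit of the standard apartment as an apartment system\<close>

definition orbit :: "('k \<times> 'k) set set set set" where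
  "orbit = (\<lambda>g. act_vset g (range std)) ` G"

lemma orbit_is_apartment:
  assumes "S \<in> orbit"
  shows "is_apartment p absv S"
proof -
  obtain g where g: "g \<in> G" "S = act_vset g (range std)"
    using assms unfolding orbit_def by (rule imageE)
  have g0: "mdet g \<noteq> 0" using mdet_normone[OF g(1)] by simp
  show ?thesis
    unfolding is_apartment_def
  proof (intro exI[of _ "\<lambda>n. act_vertex g (std n)"] conjI allI)
    show "inj (\<lambda>n. act_vertex g (std n))"
      using inj_compose[OF inj_act_vertex[OF g0] inj_std] by (simp add: comp_def)
    show "tree_adj p absv (act_vertex g (std n)) (act_vertex g (std (n + 1)))" for n
      by (simp only: tree_adj_act[OF g0] std_adj_Suc)
    show "S = range (\<lambda>n. act_vertex g (std n))"
      by (simp add: g(2) act_vset_def image_image)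
  qed
qed

lemma chambers_in_orbit_apartment:
  assumes "s \<noteq> 0" "\<beta> \<noteq> 0" "C \<in> tree_chambers p absv" "C' \<in> tree_chambers p absv"
  shows "\<exists>S\<in>orbit. C \<subseteq> S \<and> C' \<subseteq> S"
proof -
  obtain M F where M: "mdet M = 1" "finite F" "C \<subseteq> act_vset M (std ` F)" "C' \<subseteq> act_vset M (std ` F)"
    using chambers_in_common_apartment[OF assms(3,4)] .
  have "std ` F \<subseteq> tree_vertices absv" using std_in_tree by blast
  then have "\<exists>g\<in>G. \<forall>v\<in>std ` F. act_vertex g v = act_vertex M v"
    by (rule weak_approximation[OF assms(1,2) M(1) finite_imageI[OF M(2)]])
  then obtain g where g: "g \<in> G" "\<forall>v\<in>std ` F. act_vertex g v = act_vertex M v" by (elim bexE)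
  then have "act_vset M (std ` F) = act_vset g (std ` F)"
    unfolding act_vset_def by (intro image_cong) auto
  also have "\<dots> \<subseteq> act_vset g (range std)" unfolding act_vset_def by (intro image_mono) simp
  finally have "C \<subseteq> act_vset g (range std)" "C' \<subseteq> act_vset g (range std)"
    using M(3,4) by simp_all
  moreover have "act_vset g (range std) \<in> orbit" unfolding orbit_def by (rule imageI[OF g(1)])
  ultimately show ?thesis by (intro bexI) simp_all
qed

text \<open>It is enough to reach every pair from one base pair. Pulled back by \<open>g\<close>,
  the edge joins consecutive standard vertices, in either order.\<close>

lemma G_transitive_on_edges:
  assumes "s \<noteq> 0" "\<beta> = -1" and S: "S \<in> orbit" and C: "edge_of p absv S C"
  shows "\<exists>t\<in>G. act_vset t (range std) = S \<and> act_vset t {std 0, std 1} = C"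
proof -
  obtain g where g: "g \<in> G" "S = act_vset g (range std)"
    using S unfolding orbit_def by (rule imageE)
  have g0: "mdet g \<noteq> 0" using mdet_normone[OF g(1)] by simp
  obtain v w where vw: "C = {v, w}" "tree_adj p absv v w"
    using C unfolding edge_of_def tree_chambers_def by blast
  then have "v \<in> S" "w \<in> S" using C unfolding edge_of_def by simp_all
  then obtain i j where ij: "v = act_vertex g (std i)" "w = act_vertex g (std j)"
    unfolding g(2) act_vset_def by (elim imageE) simp
  have "tree_adj p absv (std i) (std j)"
    using vw(2) unfolding ij tree_adj_act[OF g0] .
  then have "j = i + 1 \<or> j = i - 1" by (rule std_adj_imp)
  then have "\<exists>l. {std i, std j} = {std l, std (l + 1)}"
  proof
    assume "j = i + 1"
    then show ?thesis by (intro exI[of _ i]) simp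
  next
    assume "j = i - 1"
    then show ?thesis by (intro exI[of _ j]) (simp add: insert_commute)
  qed
  then obtain l where l: "{std i, std j} = {std l, std (l + 1)}" ..
  obtain t where t: "t \<in> G" "act_vset t (range std) = range std"
      "act_vset t {std 0, std 1} = {std l, std (l + 1)}"
    using G_transitive_on_std_edges[OF assms(1,2), of l] by (elim bexE conjE)
  have "act_vset g {std i, std j} = C" by (simp add: act_vset_def ij vw(1))
  then show ?thesis
    using G_mmul[OF g(1) t(1)] t(2,3) g(2) l
    by (intro bexI[of _ "mmul g t"]) (simp_all only: act_vset_mmul simp_thms)
qed

lemma strongly_transitive:
  assumes "s \<noteq> 0" "\<beta> = -1"
  shows "strongly_transitive_wrt p absv G orbit"
  unfolding strongly_transitive_wrt_def is_apartment_system_def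
proof (intro conjI ballI allI impI)
  show "is_apartment p absv S" if "S \<in> orbit" for S
    using that by (rule orbit_is_apartment)
next
  fix C C' assume "C \<in> tree_chambers p absv" "C' \<in> tree_chambers p absv"
  then show "\<exists>S\<in>orbit. C \<subseteq> S \<and> C' \<subseteq> S"
    using assms by (intro chambers_in_orbit_apartment) simp_all
next
  fix g S assume g: "g \<in> G" and S: "S \<in> orbit"
  obtain h where h: "h \<in> G" "S = act_vset h (range std)"
    using S unfolding orbit_def by (rule imageE)
  have "act_vset g S = act_vset (mmul g h) (range std)"
    unfolding h(2) act_vset_mmul ..
  then show "act_vset g S \<in> orbit"
    unfolding orbit_def using G_mmul[OF g h(1)] by (rule image_eqI)
next
  fix S C S' C'
  assume "S \<in> orbit" "edge_of p absv S C"
  from G_transitive_on_edges[OF assms this]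
  obtain t where t: "t \<in> G" "act_vset t (range std) = S" "act_vset t {std 0, std 1} = C"
    by (elim bexE conjE)
  assume "S' \<in> orbit" "edge_of p absv S' C'"
  from G_transitive_on_edges[OF assms this]
  obtain t' where t': "t' \<in> G" "act_vset t' (range std) = S'" "act_vset t' {std 0, std 1} = C'"
    by (elim bexE conjE)
  have t0: "mdet t \<noteq> 0" using mdet_normone[OF t(1)] by simp
  have undo: "act_vset (minv t) (act_vset t X) = X" for X
    using t0 by (simp flip: act_vset_mmul)
  have "act_vset (mmul t' (minv t)) S = S'" "act_vset (mmul t' (minv t)) C = C'"
    unfolding act_vset_mmul t(2,3)[symmetric] undo by (fact t')+
  then show "\<exists>g\<in>G. act_vset g S = S' \<and> act_vset g C = C'"
    by (intro bexI[OF _ G_mmul[OF t'(1) G_minv[OF t(1)]]] conjI)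
qed

end

theorem theorem2:
  fixes p :: nat and \<alpha> \<beta> :: rat
    and absv :: "'k::field_char_0 \<Rightarrow> real" and s :: 'k
  assumes Qp: "is_Qp p absv"
    and div: "is_division_quat \<alpha> \<beta>"
    and prime: "prime p" and p2: "p \<noteq> 2"
    and va: "vp_rat p \<alpha> = 0" and vb: "vp_rat p \<beta> = 0"
    and sqrt: "s * s = of_rat \<alpha>"
    and beta: "has_sqrt_minus1 \<alpha> \<beta> \<longrightarrow> \<beta> = -1"
  shows "(has_sqrt_minus1 \<alpha> \<beta>
          \<longleftrightarrow> (\<exists>g\<in>normone \<alpha> \<beta>. reflects_std p absv (qmat s \<beta> g)))
       \<and> ((\<exists>g\<in>normone \<alpha> \<beta>. reflects_std p absv (qmat s \<beta> g))
          \<longleftrightarrow> (\<exists>A. strongly_transitive_wrt p absv (qmat s \<beta> ` normone \<alpha> \<beta>) A))"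
proof -
  interpret split_quaternion p absv \<alpha> \<beta> s
    by unfold_locales (fact Qp prime sqrt)+
  \<comment> \<open>Invertibility of e2 gives \<alpha> \<noteq> 0, hence s \<noteq> 0, on which the
    density arguments rest.\<close>
  have "(0, 1, 0, 0) \<noteq> qzero" by (simp add: qzero_def)
  then obtain y where "qmul \<alpha> \<beta> (0, 1, 0, 0) y = qone"
    using div unfolding is_division_quat_def by blast
  then have "\<alpha> \<noteq> 0" by (cases y rule: prod_cases4) (auto simp: qmul_def qone_def)
  then have s: "s \<noteq> 0" using sqrt by auto
  have 1: "\<exists>g\<in>normone \<alpha> \<beta>. reflects_std p absv (qmat s \<beta> g)"
    and 2: "\<exists>A. strongly_transitive_wrt p absv G A" if "has_sqrt_minus1 \<alpha> \<beta>"
  proof -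
    have \<beta>: "\<beta> = -1" using beta that by blast
    obtain g where g: "g \<in> G" "\<forall>n. act_vertex g (std n) = std (- n)"
      using reflection_in_G[OF \<beta>] by blast
    have "act_vset g (range std) = range std"
      by (rule std_apartment_stabilized[OF spec[OF g(2)]], rule surjI[of _ uminus]) simp
    then have "reflects_std p absv g"
      unfolding reflects_std_def std_apartment_def using g(2) by (intro conjI exI[of _ 0]) simp_all
    with g(1) show "\<exists>g\<in>normone \<alpha> \<beta>. reflects_std p absv (qmat s \<beta> g)" by blast
    show "\<exists>A. strongly_transitive_wrt p absv G A"
      using strongly_transitive[OF s \<beta>] by blast
  qed
  have zero: "has_sqrt_minus1 \<alpha> \<beta>" if "g \<in> G" "mtrace g = 0" for g
    using that trace_0_imp_sqrt_minus1 by (elim imageE) simp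
  have 3: "has_sqrt_minus1 \<alpha> \<beta>" if reflection: "\<exists>g\<in>normone \<alpha> \<beta>. reflects_std p absv (qmat s \<beta> g)"
  proof -
    obtain g where g: "g \<in> normone \<alpha> \<beta>" "reflects_std p absv (qmat s \<beta> g)" using reflection by blast
    then have "qmat s \<beta> g \<in> G" by simp
    then show ?thesis using zero reflects_std_trace[OF mdet_normone g(2)] by simp
  qed
  have 4: "has_sqrt_minus1 \<alpha> \<beta>" if st: "\<exists>A. strongly_transitive_wrt p absv G A"
  proof -
    obtain A where "strongly_transitive_wrt p absv G A" using st by blast
    then have "\<exists>g\<in>G. mtrace g = 0" by (rule strongly_transitive_trace[rotated]) (rule mdet_normone)
    then show ?thesis using zero by (elim bexE)
  qed
  from 1 2 3 4 show ?thesis by blast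
qed

end
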